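(* Let $G$ be a finitely generated solvable FAR group and let $H$ be a subgroup of $G$. Then $|G:H|$ is finite if and only if $\mathrm{h}(H)=\mathrm{h}(G)$.
   Context: A group $G$ has finite torsion-free rank if it has a subnormal series of finite length whose factors are either periodic (torsion) or infinite cyclic. The number $\mathrm{h}(G)$ of infinite cyclic factors in such a series is the Hirsch number, or torsion-free rank, of $G$ (it is independent of the chosen series). The $p$-rank ($p$ prime) of an abelian group is the cardinality of a maximal $\mathbb{Z}_p$-linearly independent subset of elements of order $p$ (where $\mathbb{Z}_p=\mathbb{Z}/p\mathbb{Z}$). A solvable group $G$ is a solvable FAR group (has finite abelian ranks) if there is a series of finite length in $G$ (each term normal in the next) with each factor abelian, and of finite torsion-free rank and finite $p$-rank for every prime $p$. *)

theory Defs
  imports "HOL-Algebra.Algebra"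
begin

definition finitely_generated_group :: "('a, 'b) monoid_scheme \<Rightarrow> bool" where
  "finitely_generated_group G \<longleftrightarrow>
     (\<exists>S. finite S \<and> S \<subseteq> carrier G \<and> generate G S = carrier G)"

definition periodic_group :: "('a, 'b) monoid_scheme \<Rightarrow> bool" where
  "periodic_group G \<longleftrightarrow>
     (\<forall>x \<in> carrier G. \<exists>n::nat. 0 < n \<and> x [^]\<^bsub>G\<^esub> n = \<one>\<^bsub>G\<^esub>)"

definition infinite_cyclic_group :: "'a monoid \<Rightarrow> bool" where
  "infinite_cyclic_group G \<longleftrightarrow> cyclic_group G \<and> infinite (carrier G)"

text \<open>A series of length \<open>n\<close> is \<open>{\<one>} = K 0 \<lhd> K 1 \<lhd> \<dots> \<lhd> K n = carrier G\<close>; the terms need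
  not be normal in \<open>G\<close>. The values \<open>K i\<close> for \<open>i > n\<close> play no role.\<close>

definition subnormal_series :: "('a, 'b) monoid_scheme \<Rightarrow> nat \<Rightarrow> (nat \<Rightarrow> 'a set) \<Rightarrow> bool" where
  "subnormal_series G n K \<longleftrightarrow>
     K 0 = {\<one>\<^bsub>G\<^esub>} \<and> K n = carrier G \<and>
     (\<forall>i<n. K i \<lhd> (G\<lparr>carrier := K (Suc i)\<rparr>))"

definition series_factor :: "('a, 'b) monoid_scheme \<Rightarrow> (nat \<Rightarrow> 'a set) \<Rightarrow> nat \<Rightarrow> 'a set monoid" where
  "series_factor G K i = (G\<lparr>carrier := K (Suc i)\<rparr>) Mod (K i)"

definition hirsch_series :: "('a, 'b) monoid_scheme \<Rightarrow> nat \<Rightarrow> (nat \<Rightarrow> 'a set) \<Rightarrow> bool" where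
  "hirsch_series G n K \<longleftrightarrow>
     subnormal_series G n K \<and>
     (\<forall>i<n. periodic_group (series_factor G K i) \<or> infinite_cyclic_group (series_factor G K i))"

definition finite_torsion_free_rank :: "('a, 'b) monoid_scheme \<Rightarrow> bool" where
  "finite_torsion_free_rank G \<longleftrightarrow> (\<exists>n K. hirsch_series G n K)"

text \<open>The number of infinite cyclic factors does not depend on the series, so the description
  below denotes it whenever \<open>G\<close> has finite torsion-free rank; otherwise the value is
  unspecified.\<close>

definition hirsch_number :: "('a, 'b) monoid_scheme \<Rightarrow> nat" where
  "hirsch_number G =
     (THE r. \<exists>n K. hirsch_series G n K \<and>
        r = card {i. i < n \<and> infinite_cyclic_group (series_factor G K i)})"

text \<open>Linear independence over \<open>\<int>/p\<int>\<close> in the (multiplicatively written) subgroup of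
  elements \<open>x\<close> of an abelian group with \<open>x\<^sup>p = \<one>\<close>: scalars are represented by integers, which
  act by powers, and a scalar vanishes iff \<open>p\<close> divides it.\<close>

definition Zp_independent :: "('a, 'b) monoid_scheme \<Rightarrow> nat \<Rightarrow> 'a set \<Rightarrow> bool" where
  "Zp_independent A p S \<longleftrightarrow>
     S \<subseteq> {x \<in> carrier A. group.ord A x = p} \<and>
     (\<forall>T c. finite T \<and> T \<subseteq> S \<and> (\<Otimes>\<^bsub>A\<^esub>x\<in>T. x [^]\<^bsub>A\<^esub> (c x :: int)) = \<one>\<^bsub>A\<^esub>
        \<longrightarrow> (\<forall>x\<in>T. int p dvd c x))"

text \<open>All maximal independent subsets have the same cardinality, the \<open>p\<close>-rank.\<close>

definition finite_p_rank :: "('a, 'b) monoid_scheme \<Rightarrow> nat \<Rightarrow> bool" where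
  "finite_p_rank A p \<longleftrightarrow>
     (\<exists>S. finite S \<and> Zp_independent A p S \<and>
          (\<forall>S'. Zp_independent A p S' \<and> S \<subseteq> S' \<longrightarrow> S' = S))"

definition solvable_FAR_group :: "('a, 'b) monoid_scheme \<Rightarrow> bool" where
  "solvable_FAR_group G \<longleftrightarrow>
     group G \<and> solvable G \<and>
     (\<exists>n K. subnormal_series G n K \<and>
        (\<forall>i<n. comm_group (series_factor G K i) \<and>
               finite_torsion_free_rank (series_factor G K i) \<and>
               (\<forall>p::nat. Factorial_Ring.prime p \<longrightarrow> finite_p_rank (series_factor G K i) p)))"

end

theory Submission
  imports Defs
begin

text \<open>Call a chain of subgroups \<open>1 = Q\<^sub>0 \<le> Q\<^sub>1 \<le> \<dots> \<le> L\<close> of rank \<open>k\<close> if in \<open>k\<close> of its steps the smaller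
  subgroup is normal in the larger one with a non-periodic quotient. The Hirsch number is the maximal
  rank of such a chain, which makes it monotone, and a chain in \<open>L\<close> can be split along a
  subgroup \<open>A\<close> normalised by \<open>L\<close> into a chain in \<open>L \<inter> A\<close> and one from \<open>A\<close> to \<open>LA\<close>.

  A subgroup of finite index contains a power of every element, so intersecting with it preserves the
  rank of chains. Conversely let \<open>h(H) = h(G)\<close> and let \<open>D\<^sub>i\<close> be the derived series of \<open>G\<close>. Suppose that
  \<open>M = H D\<^sub>i\<close> has finite index, hence is finitely generated, and put \<open>H' = H D\<^sub>i\<^sub>+\<^sub>1\<close>, \<open>B = D\<^sub>i \<inter> H'\<close>. Equality
  of ranks forces \<open>D\<^sub>i / B\<close> to be torsion. As \<open>M = H' D\<^sub>i\<close> is generated by finitely many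
  elements \<open>h\<^sub>j a\<^sub>j\<close> and \<open>H'\<close> normalises \<open>B\<close>, a common exponent of the \<open>a\<^sub>j\<close> modulo \<open>B\<close> is an exponent
  of \<open>D\<^sub>i / B\<close>. Abelian sections of finite exponent of a solvable FAR group are finite, so \<open>H'\<close> again has
  finite index.\<close>

section \<open>Chains of subgroups\<close>

text \<open>Equal rank alone yields periodicity and no more: the integers have full rank and
  infinite index in the rationals. Finite generation has to turn periodicity into a bounded
  exponent, but the terms of the derived series need not inherit it. Only the subgroups of finite
  index do, and for this reason the descent runs through the products of \<open>H\<close> with these
  terms.

  Nor can finiteness of abelian sections of bounded exponent be read off from the p-ranks directly,
  since a quotient may have more p-torsion than the group: the integers have none, their quotients
  do. Each abelian factor is therefore divided by a subgroup \<open>F\<close> built from one element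
  for every infinite cyclic factor. The quotient by \<open>F\<close> is periodic, and its p-torsion
  is bounded by that of the factor together with \<open>F/F^p\<close>.

  Normality, periodicity and cyclicity are all stated relative to subgroups of one ambient group,
  because every passage to a factor group changes the type of the elements.\<close>

definition normalizes :: "('a, 'b) monoid_scheme \<Rightarrow> 'a set \<Rightarrow> 'a set \<Rightarrow> bool" where
  "normalizes G L C \<longleftrightarrow> (\<forall>l\<in>L. \<forall>c\<in>C. l \<otimes>\<^bsub>G\<^esub> c \<otimes>\<^bsub>G\<^esub> inv\<^bsub>G\<^esub> l \<in> C)"

definition periodic_mod :: "('a, 'b) monoid_scheme \<Rightarrow> 'a set \<Rightarrow> 'a set \<Rightarrow> bool" where
  "periodic_mod G P Q \<longleftrightarrow> (\<forall>x\<in>Q. \<exists>n::nat. 0 < n \<and> x [^]\<^bsub>G\<^esub> n \<in> P)"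

definition infinite_cyclic_mod :: "('a, 'b) monoid_scheme \<Rightarrow> 'a set \<Rightarrow> 'a set \<Rightarrow> bool" where
  "infinite_cyclic_mod G P Q \<longleftrightarrow>
     (\<exists>t\<in>Q. (\<forall>n::nat. 0 < n \<longrightarrow> t [^]\<^bsub>G\<^esub> n \<notin> P) \<and>
            (\<forall>x\<in>Q. \<exists>k::int. x \<otimes>\<^bsub>G\<^esub> inv\<^bsub>G\<^esub> (t [^]\<^bsub>G\<^esub> k) \<in> P))"

text \<open>The lower end \<open>P\<close> is a parameter so that a chain obtained from a factor
  group and pulled back to \<open>G\<close> can be glued to a chain below it. Since every step is
  normal with periodic or infinite cyclic quotient, a chain that starts at the trivial subgroup
  bounds ranks from above.\<close>

inductive hirsch_chain :: "('a, 'b) monoid_scheme \<Rightarrow> 'a set \<Rightarrow> nat \<Rightarrow> 'a set \<Rightarrow> bool"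
  for G P where
  hc_refl: "subgroup P G \<Longrightarrow> hirsch_chain G P 0 P"
| hc_periodic: "hirsch_chain G P r Q \<Longrightarrow> subgroup R G \<Longrightarrow> Q \<subseteq> R \<Longrightarrow> normalizes G R Q
    \<Longrightarrow> periodic_mod G Q R \<Longrightarrow> hirsch_chain G P r R"
| hc_cyclic: "hirsch_chain G P r Q \<Longrightarrow> subgroup R G \<Longrightarrow> Q \<subseteq> R \<Longrightarrow> normalizes G R Q
    \<Longrightarrow> infinite_cyclic_mod G Q R \<Longrightarrow> hirsch_chain G P (Suc r) R"

text \<open>A certificate for a lower bound of the rank. Steps that do not count need no normality,
  so a chain can be cut by a subgroup or pushed into a product even where a jump is lost on the
  way.\<close>

inductive rank_chain :: "('a, 'b) monoid_scheme \<Rightarrow> 'a set \<Rightarrow> nat \<Rightarrow> 'a set \<Rightarrow> bool"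
  for G P where
  rc_refl: "subgroup P G \<Longrightarrow> rank_chain G P 0 P"
| rc_mono: "rank_chain G P k Q \<Longrightarrow> subgroup R G \<Longrightarrow> Q \<subseteq> R \<Longrightarrow> rank_chain G P k R"
| rc_jump: "rank_chain G P k Q \<Longrightarrow> subgroup R G \<Longrightarrow> Q \<subseteq> R \<Longrightarrow> normalizes G R Q
    \<Longrightarrow> \<not> periodic_mod G Q R \<Longrightarrow> rank_chain G P (Suc k) R"

lemma not_periodic_modE:
  assumes "\<not> periodic_mod G P Q"
  obtains t where "t \<in> Q" "\<And>n::nat. 0 < n \<Longrightarrow> t [^]\<^bsub>G\<^esub> n \<notin> P"
  using assms unfolding periodic_mod_def by blast

lemma normalizesD:
  "normalizes G L C \<Longrightarrow> l \<in> L \<Longrightarrow> c \<in> C \<Longrightarrow> l \<otimes>\<^bsub>G\<^esub> c \<otimes>\<^bsub>G\<^esub> inv\<^bsub>G\<^esub> l \<in> C"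
  by (auto simp: normalizes_def)

lemma normalizes_subset: "normalizes G L C \<Longrightarrow> M \<subseteq> L \<Longrightarrow> normalizes G M C"
  by (auto simp: normalizes_def)

lemma periodic_mod_mono: "periodic_mod G P Q \<Longrightarrow> P \<subseteq> P' \<Longrightarrow> Q' \<subseteq> Q \<Longrightarrow> periodic_mod G P' Q'"
  unfolding periodic_mod_def by (meson subsetD)

context group
begin

section \<open>Products with a normalised subgroup and congruences modulo it\<close>

lemma inv_cancel_left [simp]:
  assumes "x \<in> carrier G" "y \<in> carrier G"
  shows "inv x \<otimes> (x \<otimes> y) = y" "x \<otimes> (inv x \<otimes> y) = y"
  using assms by (simp_all flip: m_assoc)

lemma subgroup_nat_pow_closed:
  "subgroup H G \<Longrightarrow> x \<in> H \<Longrightarrow> x [^] (n::nat) \<in> H"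
  by (induction n) (auto simp: subgroup.one_closed subgroup.m_closed)

lemma normalizes_Int:
  assumes "subgroup H G" "normalizes G L C"
  shows "normalizes G (L \<inter> H) (C \<inter> H)"
  using assms(2) subgroup.m_closed[OF assms(1)] subgroup.m_inv_closed[OF assms(1)]
  by (auto simp: normalizes_def)

lemma normalizes_inv:
  assumes "subgroup L G" "normalizes G L C" "l \<in> L" "c \<in> C"
  shows "inv l \<otimes> c \<otimes> l \<in> C"
  using normalizesD[OF assms(2) subgroup.m_inv_closed[OF assms(1,3)] assms(4)] assms(1,3)
  by (simp add: subgroup.mem_carrier)

lemma subgroup_set_mult:
  assumes L: "subgroup L G" and C: "subgroup C G" and n: "normalizes G L C"
  shows "subgroup (L <#> C) G"
proof (rule subgroupI)
  have mem: "l \<in> carrier G" "c \<in> carrier G" if "l \<in> L" "c \<in> C" for l c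
    using that L C by (auto simp: subgroup.mem_carrier)
  show "L <#> C \<subseteq> carrier G"
    using mem by (auto simp: set_mult_def)
  show "L <#> C \<noteq> {}"
    using subgroup.one_closed[OF L] subgroup.one_closed[OF C] by (auto simp: set_mult_def)
  show "inv a \<in> L <#> C" if ab: "a \<in> L <#> C" for a
  proof -
    obtain l c where lc: "l \<in> L" "c \<in> C" "a = l \<otimes> c" using ab by (auto simp: set_mult_def)
    have "inv a = inv l \<otimes> (l \<otimes> inv c \<otimes> inv l)"
      using mem[OF lc(1,2)] lc(3) by (simp add: inv_mult_group m_assoc)
    then show ?thesis
      using normalizesD[OF n lc(1) subgroup.m_inv_closed[OF C lc(2)]] subgroup.m_inv_closed[OF L lc(1)]
      by (auto simp: set_mult_def)
  qed
  show "a \<otimes> b \<in> L <#> C" if ab: "a \<in> L <#> C" "b \<in> L <#> C" for a b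
  proof -
    obtain l c where lc: "l \<in> L" "c \<in> C" "a = l \<otimes> c" using ab by (auto simp: set_mult_def)
    obtain k d where kd: "k \<in> L" "d \<in> C" "b = k \<otimes> d" using ab by (auto simp: set_mult_def)
    have "a \<otimes> b = (l \<otimes> k) \<otimes> ((inv k \<otimes> c \<otimes> k) \<otimes> d)"
      using mem[OF lc(1,2)] mem[OF kd(1,2)] lc(3) kd(3) by (simp add: m_assoc)
    moreover have "(inv k \<otimes> c \<otimes> k) \<otimes> d \<in> C"
      using normalizes_inv[OF L n kd(1) lc(2)] kd(2) subgroup.m_closed[OF C] by blast
    ultimately show ?thesis
      using subgroup.m_closed[OF L lc(1) kd(1)] by (auto simp: set_mult_def)
  qed
qed

lemma set_mult_supset:
  assumes "subgroup L G" "subgroup C G"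
  shows "L \<subseteq> L <#> C" "C \<subseteq> L <#> C"
proof -
  have "l \<in> L <#> C" if "l \<in> L" for l
  proof -
    have "l = l \<otimes> \<one>" using that assms by (simp add: subgroup.mem_carrier)
    then show ?thesis using that subgroup.one_closed[OF assms(2)] unfolding set_mult_def by blast
  qed
  then show "L \<subseteq> L <#> C" by blast
  have "c \<in> L <#> C" if "c \<in> C" for c
  proof -
    have "c = \<one> \<otimes> c" using that assms by (simp add: subgroup.mem_carrier)
    then show ?thesis using that subgroup.one_closed[OF assms(1)] unfolding set_mult_def by blast
  qed
  then show "C \<subseteq> L <#> C" by blast
qed

lemma set_mult_least:
  assumes "subgroup M G" "L \<subseteq> M" "C \<subseteq> M"
  shows "L <#> C \<subseteq> M"
  using assms by (auto simp: set_mult_def intro!: subgroup.m_closed)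

lemma normalizes_set_mult:
  assumes Q: "subgroup Q G" and P: "subgroup P G" and A: "subgroup A G"
    and PQ: "P \<subseteq> Q" and n: "normalizes G Q P" and nA: "normalizes G Q A"
  shows "normalizes G (Q <#> A) (P <#> A)"
  unfolding normalizes_def
proof (intro ballI)
  fix u v assume "u \<in> Q <#> A" "v \<in> P <#> A"
  then obtain q a where qa: "q \<in> Q" "a \<in> A" "u = q \<otimes> a" by (auto simp: set_mult_def)
  have PA: "subgroup (P <#> A) G"
    using subgroup_set_mult[OF P A normalizes_subset[OF nA PQ]] .
  have "a \<in> P <#> A" using set_mult_supset(2)[OF P A] qa by blast
  then have "a \<otimes> v \<otimes> inv a \<in> P <#> A"
    using PA \<open>v \<in> P <#> A\<close> by (simp add: subgroup.m_closed subgroup.m_inv_closed)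
  then obtain p b where pb: "p \<in> P" "b \<in> A" "a \<otimes> v \<otimes> inv a = p \<otimes> b" by (auto simp: set_mult_def)
  have c: "q \<in> carrier G" "a \<in> carrier G" "v \<in> carrier G" "p \<in> carrier G" "b \<in> carrier G"
    using qa pb \<open>v \<in> P <#> A\<close> Q A P PA by (auto simp: subgroup.mem_carrier)
  have "u \<otimes> v \<otimes> inv u = q \<otimes> (a \<otimes> v \<otimes> inv a) \<otimes> inv q"
    using c qa(3) by (simp add: inv_mult_group m_assoc)
  also have "\<dots> = (q \<otimes> p \<otimes> inv q) \<otimes> (q \<otimes> b \<otimes> inv q)"
    unfolding pb(3) using c by (simp add: m_assoc)
  finally show "u \<otimes> v \<otimes> inv u \<in> P <#> A"
    using normalizesD[OF n qa(1) pb(1)] normalizesD[OF nA qa(1) pb(2)] unfolding set_mult_def by blast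
qed

text \<open>Telescoping replaces the quotient map: \<open>x^(k+1) y^(-k-1)\<close> is the conjugate
  of \<open>x y^(-1)\<close> by \<open>x^k\<close>, times \<open>x^k y^(-k)\<close>.\<close>

lemma nat_pow_cong_mod:
  assumes Q: "subgroup Q G" and P: "subgroup P G" and n: "normalizes G Q P"
    and x: "x \<in> Q" and y: "y \<in> Q" and xy: "x \<otimes> inv y \<in> P"
  shows "x [^] (k::nat) \<otimes> inv (y [^] k) \<in> P"
proof (induction k)
  case 0
  then show ?case using P by (simp add: subgroup.one_closed)
next
  case (Suc k)
  have c: "x \<in> carrier G" "y \<in> carrier G" using x y Q by (auto simp: subgroup.mem_carrier)
  have "x [^] Suc k \<otimes> inv (y [^] Suc k) =
      (x [^] k \<otimes> (x \<otimes> inv y) \<otimes> inv (x [^] k)) \<otimes> (x [^] k \<otimes> inv (y [^] k))"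
    using c by (simp add: inv_mult_group m_assoc)
  then show ?case
    using Suc.IH normalizesD[OF n subgroup_nat_pow_closed[OF Q x, of k] xy] subgroup.m_closed[OF P]
    by simp
qed

lemma int_pow_cong_mod:
  assumes Q: "subgroup Q G" and P: "subgroup P G" and n: "normalizes G Q P"
    and x: "x \<in> Q" and y: "y \<in> Q" and xy: "x \<otimes> inv y \<in> P"
  shows "x [^] (k::int) \<otimes> inv (y [^] k) \<in> P"
proof -
  have c: "x \<in> carrier G" "y \<in> carrier G" using x y Q by (auto simp: subgroup.mem_carrier)
  \<comment> \<open>Negative exponents come from the natural case for \<open>inv x\<close> and
    \<open>inv y\<close>. These are congruent because \<open>inv x \<otimes> y\<close> is a
    conjugate of \<open>inv (x \<otimes> inv y)\<close>.\<close>
  have "inv (x \<otimes> inv y) \<in> P" using subgroup.m_inv_closed[OF P xy] .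
  then have "inv x \<otimes> (y \<otimes> inv x) \<otimes> x \<in> P"
    using normalizes_inv[OF Q n x] c by (simp add: inv_mult_group)
  then have "inv x \<otimes> inv (inv y) \<in> P" using c by (simp add: m_assoc)
  from nat_pow_cong_mod[OF Q P n _ _ this] nat_pow_cong_mod[OF Q P n x y xy]
  show ?thesis
    using c subgroup.m_inv_closed[OF Q] x y
    by (cases k rule: int_cases2) (auto simp: int_pow_int int_pow_neg_int nat_pow_inv)
qed

section \<open>Gluing, splitting and comparing chains\<close>

lemma rank_chain_subgroup: "rank_chain G P k Q \<Longrightarrow> subgroup P G \<and> subgroup Q G \<and> P \<subseteq> Q"
  by (induction rule: rank_chain.induct) auto

lemma hirsch_chain_subgroup: "hirsch_chain G P k Q \<Longrightarrow> subgroup P G \<and> subgroup Q G \<and> P \<subseteq> Q"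
  by (induction rule: hirsch_chain.induct) auto

lemma rank_chain_trans:
  assumes "rank_chain G Q l R" "rank_chain G P k Q"
  shows "rank_chain G P (k + l) R"
  using assms
  by (induction rule: rank_chain.induct) (auto intro: rank_chain.intros)

lemma hirsch_chain_trans:
  assumes "hirsch_chain G Q l R" "hirsch_chain G P k Q"
  shows "hirsch_chain G P (k + l) R"
  using assms
  by (induction rule: hirsch_chain.induct) (auto intro: hirsch_chain.intros)

lemma infinite_cyclic_mod_not_periodic:
  "infinite_cyclic_mod G P Q \<Longrightarrow> \<not> periodic_mod G P Q"
  by (auto simp: infinite_cyclic_mod_def periodic_mod_def)

lemma hirsch_chain_imp_rank_chain: "hirsch_chain G P r Q \<Longrightarrow> rank_chain G P r Q"
  by (induction rule: hirsch_chain.induct)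
    (auto intro: rank_chain.intros dest: infinite_cyclic_mod_not_periodic)

text \<open>Each jump from \<open>P\<close> to \<open>Q\<close> survives in one of the two parts.
  Either \<open>Q \<inter> A\<close> is not periodic modulo \<open>P \<inter> A\<close>, and the
  jump is counted inside \<open>A\<close>, or it is counted between \<open>P <#> A\<close> and
  \<open>Q <#> A\<close>. The other part takes an uncounted step.\<close>

lemma rank_chain_split:
  assumes "rank_chain G {\<one>} k L" "subgroup A G" "normalizes G L A"
  shows "\<exists>i j. i + j = k \<and> rank_chain G {\<one>} i (L \<inter> A) \<and> rank_chain G A j (L <#> A)"
  using assms(1,3)
proof (induction rule: rank_chain.induct)
  case rc_refl
  have "{\<one>} \<inter> A = {\<one>}" "{\<one>} <#> A = A"
    using assms(2) by (auto simp: subgroup.one_closed set_mult_def subgroup.mem_carrier)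
  then show ?case
    using rank_chain.rc_refl[OF assms(2)] rank_chain.rc_refl[OF rc_refl(1)] by auto
next
  case (rc_mono k Q R)
  have nQ: "normalizes G Q A" using normalizes_subset rc_mono by blast
  from rc_mono.IH[OF nQ] obtain i j where ij: "i + j = k" "rank_chain G {\<one>} i (Q \<inter> A)" "rank_chain G A j (Q <#> A)"
    by blast
  have "rank_chain G {\<one>} i (R \<inter> A)"
    by (rule rank_chain.rc_mono[OF ij(2) subgroups_Inter_pair[OF rc_mono(2) assms(2)]])
      (use rc_mono(3) in blast)
  moreover have "rank_chain G A j (R <#> A)"
    using rank_chain.rc_mono[OF ij(3) subgroup_set_mult[OF rc_mono(2) assms(2) rc_mono(5)]] rc_mono(3)
    by (meson mono_set_mult subset_refl)
  ultimately show ?case using ij(1) by blast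
next
  case (rc_jump k P Q)
  have nP: "normalizes G P A" using normalizes_subset rc_jump by blast
  from rc_jump.IH[OF nP] obtain i j where ij: "i + j = k" "rank_chain G {\<one>} i (P \<inter> A)" "rank_chain G A j (P <#> A)"
    by blast
  have sP: "subgroup P G" using rank_chain_subgroup[OF rc_jump(1)] by blast
  have sQ: "subgroup Q G" by fact
  have QA: "subgroup (Q \<inter> A) G" "subgroup (Q <#> A) G"
    using subgroups_Inter_pair[OF sQ assms(2)] subgroup_set_mult[OF sQ assms(2) rc_jump(7)] by auto
  have le: "P \<inter> A \<subseteq> Q \<inter> A" "P <#> A \<subseteq> Q <#> A"
    using rc_jump(3) by (auto simp: set_mult_def)
  show ?case
  proof (cases "periodic_mod G (P \<inter> A) (Q \<inter> A)")
    case False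
    have "rank_chain G {\<one>} (Suc i) (Q \<inter> A)"
      using rank_chain.rc_jump[OF ij(2) QA(1) le(1) normalizes_Int[OF assms(2) rc_jump(4)] False] .
    moreover have "rank_chain G A j (Q <#> A)"
      using rank_chain.rc_mono[OF ij(3) QA(2) le(2)] .
    ultimately show ?thesis using ij(1) by (metis add_Suc)
  next
    case True
    obtain t where t: "t \<in> Q" "\<And>n::nat. 0 < n \<Longrightarrow> t [^] n \<notin> P"
      using not_periodic_modE[OF rc_jump(5)] by blast
    have tc: "t \<in> carrier G" using t sQ by (simp add: subgroup.mem_carrier)
    \<comment> \<open>An equation \<open>t^n = p a\<close> would put \<open>a\<close> into
      \<open>Q \<inter> A\<close> and make it congruent to \<open>t^n\<close> modulo
      \<open>P\<close>. As \<open>Q \<inter> A\<close> is now periodic modulo \<open>P\<close>, a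
      power of \<open>a\<close>, hence one of \<open>t\<close>, would fall into
      \<open>P\<close>.\<close>
    have "t [^] n \<notin> P <#> A" if "0 < n" for n :: nat
    proof
      assume "t [^] n \<in> P <#> A"
      then obtain p a where pa: "p \<in> P" "a \<in> A" "t [^] n = p \<otimes> a" by (auto simp: set_mult_def)
      have c: "p \<in> carrier G" "a \<in> carrier G"
        using pa sP assms(2) by (auto simp: subgroup.mem_carrier)
      have tn: "t [^] n \<in> Q" using subgroup_nat_pow_closed[OF sQ t(1)] .
      have "a = inv p \<otimes> t [^] n" using pa c by simp
      then have aQ: "a \<in> Q"
        using tn pa(1) rc_jump(3) sQ by (auto simp: subgroup.m_closed subgroup.m_inv_closed)
      have "a \<otimes> inv (t [^] n) = inv p" using pa c by (simp add: inv_mult_group)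
      then have "a \<otimes> inv (t [^] n) \<in> P" using pa(1) sP by (simp add: subgroup.m_inv_closed)
      from nat_pow_cong_mod[OF sQ sP rc_jump(4) aQ tn this]
      have cong: "a [^] m \<otimes> inv ((t [^] n) [^] m) \<in> P" for m :: nat .
      obtain m :: nat where m: "0 < m" "a [^] m \<in> P"
        using True aQ pa(2) unfolding periodic_mod_def by blast
      have "inv (a [^] m) \<otimes> (a [^] m \<otimes> inv ((t [^] n) [^] m)) \<in> P"
        using cong[of m] m(2) sP by (simp add: subgroup.m_closed subgroup.m_inv_closed)
      then have "inv ((t [^] n) [^] m) \<in> P" using c tc by simp
      then have "(t [^] n) [^] m \<in> P" using sP tc by (metis inv_inv nat_pow_closed subgroup.m_inv_closed)
      then have "t [^] (n * m) \<in> P" using tc by (simp add: nat_pow_pow)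
      then show False using t(2)[of "n * m"] that m(1) by simp
    qed
    moreover have "t \<in> Q <#> A" using set_mult_supset(1)[OF sQ assms(2)] t(1) by blast
    ultimately have "\<not> periodic_mod G (P <#> A) (Q <#> A)" unfolding periodic_mod_def by blast
    then have "rank_chain G A (Suc j) (Q <#> A)"
      using rank_chain.rc_jump[OF ij(3) QA(2) le(2)]
        normalizes_set_mult[OF sQ sP assms(2) rc_jump(3,4,7)] by blast
    moreover have "rank_chain G {\<one>} i (Q \<inter> A)" using rank_chain.rc_mono[OF ij(2) QA(1) le(1)] .
    ultimately show ?thesis using ij(1) by (metis add_Suc_right)
  qed
qed

text \<open>If no positive power of \<open>t\<close> lies in \<open>P\<close>, the same is true of
  any power \<open>t^n\<close> with \<open>0 < n\<close>, and one of these lies in \<open>S\<close>.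
  So every jump is still witnessed inside \<open>S\<close>.\<close>

lemma rank_chain_Int_root:
  assumes "rank_chain G {\<one>} k L" "subgroup S G" "periodic_mod G S (carrier G)"
  shows "rank_chain G {\<one>} k (L \<inter> S)"
  using assms(1)
proof (induction rule: rank_chain.induct)
  case rc_refl
  have "{\<one>} \<inter> S = {\<one>}" using assms(2) by (auto simp: subgroup.one_closed)
  then show ?case using rank_chain.rc_refl[OF rc_refl] by simp
next
  case (rc_mono k Q R)
  show ?case
    by (rule rank_chain.rc_mono[OF rc_mono.IH subgroups_Inter_pair[OF rc_mono(2) assms(2)]])
      (use rc_mono(3) in blast)
next
  case (rc_jump k P Q)
  obtain t where t: "t \<in> Q" "\<And>n::nat. 0 < n \<Longrightarrow> t [^] n \<notin> P"
    using not_periodic_modE[OF rc_jump(5)] by blast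
  have tc: "t \<in> carrier G" using t rc_jump(2) by (simp add: subgroup.mem_carrier)
  then obtain n :: nat where n: "0 < n" "t [^] n \<in> S" using assms(3) by (auto simp: periodic_mod_def)
  have "(t [^] n) [^] m \<notin> P" if "0 < m" for m :: nat
    using t(2)[of "n * m"] n that tc by (simp add: nat_pow_pow)
  then have "\<not> periodic_mod G (P \<inter> S) (Q \<inter> S)"
    using n subgroup_nat_pow_closed[OF rc_jump(2) t(1)] unfolding periodic_mod_def by blast
  moreover have "P \<inter> S \<subseteq> Q \<inter> S" using rc_jump(3) by blast
  ultimately show ?case
    using rank_chain.rc_jump[OF rc_jump.IH subgroups_Inter_pair[OF rc_jump(2) assms(2)] _
        normalizes_Int[OF assms(2) rc_jump(4)]] by simp
qed

text \<open>A nonzero integer has a multiple in common with any other integer. If \<open>s\<close>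
  and \<open>t\<close> are congruent to \<open>g^k\<close> and \<open>g^l\<close>, then
  \<open>t^|k|\<close> is congruent to \<open>s^(sgn k * l)\<close>; moving the sign of
  \<open>k\<close> to the other side keeps \<open>m\<close> a positive natural number.\<close>

lemma infinite_cyclic_mod_power:
  assumes R: "subgroup R G" and N: "subgroup N G" and n: "normalizes G R N"
    and cyc: "infinite_cyclic_mod G N R" and s: "s \<in> R" "s \<notin> N" and t: "t \<in> R"
  shows "\<exists>m l. 0 < m \<and> t [^] (m::nat) \<otimes> inv (s [^] (l::int)) \<in> N"
proof -
  obtain g where g: "g \<in> R" and gen: "\<And>x. x \<in> R \<Longrightarrow> \<exists>k::int. x \<otimes> inv (g [^] k) \<in> N"
    using cyc unfolding infinite_cyclic_mod_def by blast
  obtain k :: int where k: "s \<otimes> inv (g [^] k) \<in> N" using gen[OF s(1)] by blast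
  obtain l :: int where l: "t \<otimes> inv (g [^] l) \<in> N" using gen[OF t] by blast
  have gk: "g [^] i \<in> R" for i :: int using subgroup_int_pow_closed[OF R g] .
  have c: "g \<in> carrier G" "s \<in> carrier G" "t \<in> carrier G" using g s t R by (auto simp: subgroup.mem_carrier)
  have "k \<noteq> 0" using k s(2) c by (metis int_pow_0 inv_one r_one)
  define m where "m = nat \<bar>k\<bar>"
  define z where "z = sgn k * l"
  have "t [^] int m \<otimes> inv ((g [^] l) [^] int m) \<in> N"
    using int_pow_cong_mod[OF R N n t gk l] .
  moreover have "inv (s [^] z \<otimes> inv ((g [^] k) [^] z)) \<in> N"
    using int_pow_cong_mod[OF R N n s(1) gk k] N by (simp add: subgroup.m_inv_closed)
  moreover have "(g [^] k) [^] z = (g [^] l) [^] int m"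
  proof -
    have "k * z = l * int m" unfolding m_def z_def using \<open>k \<noteq> 0\<close> by (cases "k > 0") auto
    then show ?thesis using c by (simp add: int_pow_pow)
  qed
  ultimately have "(t [^] int m \<otimes> inv ((g [^] l) [^] int m)) \<otimes> inv (s [^] z \<otimes> inv ((g [^] l) [^] int m)) \<in> N"
    using N by (simp add: subgroup.m_closed)
  then have "t [^] int m \<otimes> inv (s [^] z) \<in> N"
    using c by (simp add: inv_mult_group m_assoc)
  then have "t [^] m \<otimes> inv (s [^] z) \<in> N" by (simp add: int_pow_int)
  moreover have "0 < m" using \<open>k \<noteq> 0\<close> by (simp add: m_def)
  ultimately show ?thesis by blast
qed

text \<open>The clause \<open>\<not> L \<subseteq> N\<close> strengthens the induction. Once a jump
  has been made, the chain contains some \<open>s\<close> outside \<open>N\<close>; every element of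
  \<open>R\<close> has a positive power congruent to a power of \<open>s\<close> modulo
  \<open>N\<close>, which rules out a second jump.\<close>

lemma rank_chain_over_cyclic:
  assumes "rank_chain G N k L" and R: "subgroup R G" and N: "subgroup N G" and n: "normalizes G R N"
    and cyc: "infinite_cyclic_mod G N R" and "L \<subseteq> R"
  shows "k = 0 \<or> k = 1 \<and> \<not> L \<subseteq> N"
  using assms(1,6)
proof (induction rule: rank_chain.induct)
  case (rc_jump k P Q)
  have sP: "subgroup P G" and NP: "N \<subseteq> P" using rank_chain_subgroup[OF rc_jump(1)] by auto
  obtain t where t: "t \<in> Q" "\<And>n::nat. 0 < n \<Longrightarrow> t [^] n \<notin> P"
    using not_periodic_modE[OF rc_jump(5)] by blast
  have tc: "t \<in> carrier G" using t rc_jump(2) by (simp add: subgroup.mem_carrier)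
  have "t \<notin> N" using t(2)[of 1] NP tc by auto
  moreover have "k \<noteq> 1 \<or> P \<subseteq> N"
  proof (rule ccontr)
    assume "\<not> (k \<noteq> 1 \<or> P \<subseteq> N)"
    then obtain s where s: "s \<in> P" "s \<notin> N" by blast
    then have "s \<in> R" "t \<in> R" using rc_jump t by auto
    from infinite_cyclic_mod_power[OF R N n cyc this(1) s(2) this(2)]
    obtain m l where ml: "0 < (m::nat)" "t [^] m \<otimes> inv (s [^] (l::int)) \<in> N" by blast
    have "(t [^] m \<otimes> inv (s [^] l)) \<otimes> s [^] l \<in> P"
      using ml(2) NP subgroup_int_pow_closed[OF sP s(1)] sP by (auto simp: subgroup.m_closed)
    then have "t [^] m \<in> P"
      using tc s(1) sP by (simp add: m_assoc subgroup.mem_carrier)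
    then show False using t(2) ml(1) by blast
  qed
  ultimately show ?case using rc_jump.IH rc_jump(3) rc_jump.prems t(1) by auto
next
  case (rc_mono k Q L)
  then have "Q \<subseteq> R" by blast
  with rc_mono.IH rc_mono(3) show ?case by blast
qed simp

lemma rank_chain_over_periodic:
  assumes "rank_chain G N k L" "periodic_mod G N L"
  shows "k = 0"
  using assms
proof (induction rule: rank_chain.induct)
  case rc_refl
  show ?case ..
next
  case (rc_mono k Q R)
  show ?case using rc_mono.IH periodic_mod_mono[OF rc_mono.prems subset_refl rc_mono(3)] by simp
next
  case (rc_jump k P Q)
  have "N \<subseteq> P" using rank_chain_subgroup[OF rc_jump(1)] by blast
  with rc_jump(5) periodic_mod_mono[OF rc_jump.prems _ subset_refl] show ?case by simp
qed

text \<open>The chain in \<open>L\<close> is split along the last proper term \<open>Q\<close> of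
  the other chain. The part in \<open>L \<inter> Q\<close> is bounded by induction, and the part
  from \<open>Q\<close> to \<open>L <#> Q\<close>, which stays below \<open>R\<close>, has rank 0 or
  at most 1 according to the kind of step. Allowing \<open>L\<close> to be smaller than
  \<open>R\<close> gives monotonicity of the Hirsch number together with its uniqueness.\<close>

lemma rank_chain_le_hirsch_chain:
  assumes "hirsch_chain G {\<one>} r R" "rank_chain G {\<one>} k L" "L \<subseteq> R"
  shows "k \<le> r"
  using assms
proof (induction arbitrary: k L rule: hirsch_chain.induct)
  case hc_refl
  have "periodic_mod G {\<one>} L" using hc_refl(3) unfolding periodic_mod_def
    by (auto intro!: exI[of _ "1::nat"])
  then show ?case using rank_chain_over_periodic[OF hc_refl(2)] by simp
next
  case (hc_periodic r Q R)
  have sQ: "subgroup Q G" using hirsch_chain_subgroup[OF hc_periodic(1)] by blast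
  obtain i j where ij: "i + j = k" "rank_chain G {\<one>} i (L \<inter> Q)" "rank_chain G Q j (L <#> Q)"
    using rank_chain_split[OF hc_periodic(7) sQ normalizes_subset[OF hc_periodic(4,8)]] by blast
  have "i \<le> r" using hc_periodic.IH[OF ij(2)] by blast
  moreover have "L <#> Q \<subseteq> R" using set_mult_least[OF hc_periodic(2) hc_periodic(8,3)] .
  then have "j = 0"
    using rank_chain_over_periodic[OF ij(3)] periodic_mod_mono[OF hc_periodic(5)] by blast
  ultimately show ?case using ij(1) by simp
next
  case (hc_cyclic r Q R)
  have sQ: "subgroup Q G" using hirsch_chain_subgroup[OF hc_cyclic(1)] by blast
  obtain i j where ij: "i + j = k" "rank_chain G {\<one>} i (L \<inter> Q)" "rank_chain G Q j (L <#> Q)"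
    using rank_chain_split[OF hc_cyclic(7) sQ normalizes_subset[OF hc_cyclic(4,8)]] by blast
  have "i \<le> r" using hc_cyclic.IH[OF ij(2)] by blast
  moreover have "L <#> Q \<subseteq> R" using set_mult_least[OF hc_cyclic(2) hc_cyclic(8,3)] .
  then have "j \<le> 1"
    using rank_chain_over_cyclic[OF ij(3) hc_cyclic(2) sQ hc_cyclic(4,5)] by auto
  ultimately show ?case using ij(1) by simp
qed

lemma hirsch_chain_unique:
  assumes "hirsch_chain G {\<one>} r R" "hirsch_chain G {\<one>} s R"
  shows "r = s"
  using rank_chain_le_hirsch_chain[OF assms(1) hirsch_chain_imp_rank_chain[OF assms(2)]]
    rank_chain_le_hirsch_chain[OF assms(2) hirsch_chain_imp_rank_chain[OF assms(1)]] by simp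

end

section \<open>The Hirsch number\<close>

context normal
begin

lemma group_hom_r_coset: "group_hom G (G Mod H) (\<lambda>a. H #> a)"
  by (intro group_hom.intro group_hom_axioms.intro group_axioms factorgroup_is_group r_coset_hom_Mod)

lemma r_coset_eq_self_iff: "a \<in> carrier G \<Longrightarrow> H #> a = H \<longleftrightarrow> a \<in> H"
  using coset_join1 coset_join2 subgroup_axioms by blast

lemma r_coset_eq_iff:
  assumes "a \<in> carrier G" "b \<in> carrier G"
  shows "H #> a = H #> b \<longleftrightarrow> a \<otimes> inv b \<in> H"
proof -
  interpret h: group_hom G "G Mod H" "\<lambda>a. H #> a" by (rule group_hom_r_coset)
  have "H #> (a \<otimes> inv b) = (H #> a) \<otimes>\<^bsub>G Mod H\<^esub> inv\<^bsub>G Mod H\<^esub> (H #> b)"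
    using assms by simp
  then have "H #> (a \<otimes> inv b) = H \<longleftrightarrow> (H #> a) \<otimes>\<^bsub>G Mod H\<^esub> inv\<^bsub>G Mod H\<^esub> (H #> b) = \<one>\<^bsub>G Mod H\<^esub>"
    by simp
  also have "\<dots> \<longleftrightarrow> H #> a = H #> b"
    using h.H.inv_equality h.H.inv_inv h.hom_closed[OF assms(1)] h.hom_closed[OF assms(2)]
    by (metis h.H.inv_closed h.H.r_inv)
  finally show ?thesis
    using r_coset_eq_self_iff[OF m_closed[OF assms(1) inv_closed[OF assms(2)]]] by blast
qed

lemma periodic_FactGroup_iff: "periodic_group (G Mod H) \<longleftrightarrow> periodic_mod G H (carrier G)"
  unfolding periodic_group_def periodic_mod_def carrier_FactGroup ball_simps
  by (intro ball_cong refl) (simp add: FactGroup_pow r_coset_eq_self_iff)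

end

text \<open>The left side is the body of \<open>infinite_cyclic_group\<close>, whose type admits
  plain monoids only, whereas \<open>G\<close> may be an extended record here.\<close>

lemma (in group) infinite_cyclic_group_iff:
  "cyclic_group G \<and> infinite (carrier G) \<longleftrightarrow>
    (\<exists>t\<in>carrier G. (\<forall>n::nat. 0 < n \<longrightarrow> t [^] n \<noteq> \<one>) \<and> (\<forall>x\<in>carrier G. \<exists>k::int. x = t [^] k))"
proof
  assume a: "cyclic_group G \<and> infinite (carrier G)"
  then obtain t where t: "t \<in> carrier G" "subgroup_generated G {t} = G"
    unfolding cyclic_group_def by blast
  then have "carrier G = range (\<lambda>n::int. t [^] n)"
    by (metis carrier_subgroup_generated_by_singleton)
  moreover have "\<not> (\<exists>n::nat. n \<noteq> 0 \<and> t [^] n = \<one>)"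
    using finite_cyclic_subgroup[OF t(1)] t(2) a by simp
  ultimately show "\<exists>t\<in>carrier G. (\<forall>n::nat. 0 < n \<longrightarrow> t [^] n \<noteq> \<one>) \<and> (\<forall>x\<in>carrier G. \<exists>k::int. x = t [^] k)"
    using t(1) by blast
next
  assume "\<exists>t\<in>carrier G. (\<forall>n::nat. 0 < n \<longrightarrow> t [^] n \<noteq> \<one>) \<and> (\<forall>x\<in>carrier G. \<exists>k::int. x = t [^] k)"
  then obtain t where t: "t \<in> carrier G" "\<And>n::nat. 0 < n \<Longrightarrow> t [^] n \<noteq> \<one>"
    "\<And>x. x \<in> carrier G \<Longrightarrow> \<exists>k::int. x = t [^] k"
    by blast
  have "carrier G \<subseteq> range (\<lambda>n::int. t [^] n)" using t(3) by (metis rangeI subsetI)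
  then have c: "carrier G = range (\<lambda>n::int. t [^] n)" using t(1) by auto
  then have "cyclic_group G" using cyclic_group t(1) by blast
  moreover have "infinite (carrier (subgroup_generated G {t}))"
    using finite_cyclic_subgroup[OF t(1)] t(2) by blast
  then have "infinite (carrier G)"
    using carrier_subgroup_generated_by_singleton[OF t(1)] c by simp
  ultimately show "cyclic_group G \<and> infinite (carrier G)" by blast
qed

lemma (in normal) infinite_cyclic_FactGroup_iff:
  "infinite_cyclic_group (G Mod H) \<longleftrightarrow> infinite_cyclic_mod G H (carrier G)"
proof -
  interpret F: group "G Mod H" by (rule factorgroup_is_group)
  have "(\<forall>n::nat. 0 < n \<longrightarrow> (H #> t) [^]\<^bsub>G Mod H\<^esub> n \<noteq> \<one>\<^bsub>G Mod H\<^esub>) \<longleftrightarrow> (\<forall>n::nat. 0 < n \<longrightarrow> t [^] n \<notin> H)"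
    if "t \<in> carrier G" for t
    using that by (simp add: FactGroup_pow r_coset_eq_self_iff)
  moreover have "H #> x = (H #> t) [^]\<^bsub>G Mod H\<^esub> k \<longleftrightarrow> x \<otimes> inv (t [^] k) \<in> H"
    if "t \<in> carrier G" "x \<in> carrier G" for t x and k :: int
    using that r_coset_eq_iff[of x "t [^] k"] by (simp add: FactGroup_int_pow)
  ultimately show ?thesis
    unfolding infinite_cyclic_group_def F.infinite_cyclic_group_iff infinite_cyclic_mod_def
    unfolding carrier_FactGroup ball_simps bex_simps
    by (intro bex_cong conj_cong ball_cong refl ex_cong1) auto
qed

context group
begin

lemma subgroup_mult_inv_closed:
  "subgroup H G \<Longrightarrow> x \<in> H \<Longrightarrow> y \<in> H \<Longrightarrow> x \<otimes> inv y \<in> H"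
  by (simp add: subgroup.m_closed subgroup.m_inv_closed)

lemma periodic_mod_restrict: "periodic_mod (G\<lparr>carrier := R\<rparr>) N S \<longleftrightarrow> periodic_mod G N S"
  by (simp add: periodic_mod_def flip: nat_pow_consistent)

lemma infinite_cyclic_mod_restrict:
  assumes "subgroup R G" "S \<subseteq> R"
  shows "infinite_cyclic_mod (G\<lparr>carrier := R\<rparr>) N S \<longleftrightarrow> infinite_cyclic_mod G N S"
proof -
  have "t [^]\<^bsub>G\<lparr>carrier := R\<rparr>\<^esub> (k::int) = t [^] k"
    "inv\<^bsub>G\<lparr>carrier := R\<rparr>\<^esub> (t [^] k) = inv (t [^] k)" if "t \<in> S" for t k
    using that assms m_inv_consistent[OF assms(1) subgroup_int_pow_closed[OF assms(1)]]
    by (auto simp flip: int_pow_consistent)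
  then show ?thesis
    by (simp add: infinite_cyclic_mod_def flip: nat_pow_consistent cong: bex_cong)
qed

lemma normalizes_restrict:
  assumes "subgroup R G" "S \<subseteq> R"
  shows "normalizes (G\<lparr>carrier := R\<rparr>) S N \<longleftrightarrow> normalizes G S N"
  using assms by (force simp: normalizes_def)

lemma normal_restrict_iff:
  assumes "subgroup R G"
  shows "N \<lhd> G\<lparr>carrier := R\<rparr> \<longleftrightarrow> subgroup N G \<and> N \<subseteq> R \<and> normalizes G R N"
proof -
  interpret R: group "G\<lparr>carrier := R\<rparr>" using subgroup_imp_group[OF assms] .
  have "subgroup N (G\<lparr>carrier := R\<rparr>) \<longleftrightarrow> subgroup N G \<and> N \<subseteq> R"
    using subgroup_incl[OF _ assms] incl_subgroup[OF assms] subgroup.subset[of N "G\<lparr>carrier := R\<rparr>"]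
    by auto
  moreover have "(\<forall>x\<in>R. \<forall>h\<in>N. x \<otimes> h \<otimes> inv\<^bsub>G\<lparr>carrier := R\<rparr>\<^esub> x \<in> N) \<longleftrightarrow> normalizes G R N"
    using assms by (simp add: normalizes_def)
  ultimately show ?thesis unfolding R.normal_inv_iff by simp
qed

lemma periodic_factor_iff:
  assumes "N \<lhd> G\<lparr>carrier := R\<rparr>"
  shows "periodic_group (G\<lparr>carrier := R\<rparr> Mod N) \<longleftrightarrow> periodic_mod G N R"
  using normal.periodic_FactGroup_iff[OF assms] by (simp add: periodic_mod_restrict)

lemma infinite_cyclic_factor_iff:
  assumes "subgroup R G" "N \<lhd> G\<lparr>carrier := R\<rparr>"
  shows "infinite_cyclic_group (G\<lparr>carrier := R\<rparr> Mod N) \<longleftrightarrow> infinite_cyclic_mod G N R"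
  using normal.infinite_cyclic_FactGroup_iff[OF assms(2)]
  by (simp add: infinite_cyclic_mod_restrict[OF assms(1)])

section \<open>Translation between Hirsch series and chains\<close>

lemma hirsch_chain_restrict:
  assumes "hirsch_chain (G\<lparr>carrier := R\<rparr>) P r Q" "subgroup R G"
  shows "hirsch_chain G P r Q"
  using assms(1)
proof (induction rule: hirsch_chain.induct)
  case hc_refl
  then show ?case using incl_subgroup[OF assms(2)] by (blast intro: hirsch_chain.hc_refl)
next
  case (hc_periodic r Q S)
  have "S \<subseteq> R" using subgroup.subset[OF hc_periodic(2)] by simp
  then show ?case
    using hc_periodic incl_subgroup[OF assms(2)] hirsch_chain.hc_periodic[OF hc_periodic.IH]
    by (simp add: periodic_mod_restrict normalizes_restrict[OF assms(2)])
next
  case (hc_cyclic r Q S)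
  have "S \<subseteq> R" using subgroup.subset[OF hc_cyclic(2)] by simp
  then show ?case
    using hc_cyclic incl_subgroup[OF assms(2)] hirsch_chain.hc_cyclic[OF hc_cyclic.IH]
    by (simp add: infinite_cyclic_mod_restrict[OF assms(2)] normalizes_restrict[OF assms(2)])
qed

text \<open>Each term is known to be a subgroup only relative to the next one, so the induction
  descends from the top term \<open>H\<close>.\<close>

lemma subnormal_series_subgroup:
  assumes "subnormal_series (G\<lparr>carrier := H\<rparr>) n K" "subgroup H G" "i \<le> n"
  shows "subgroup (K i) G"
  using assms(3)
proof (induction rule: inc_induct)
  case base
  then show ?case using assms by (simp add: subnormal_series_def)
next
  case (step i)
  then show ?case
    using assms(1) incl_subgroup[OF step.IH normal_imp_subgroup, of "K i"]
    by (simp add: subnormal_series_def)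
qed

lemma hirsch_chain_of_series:
  assumes "hirsch_series (G\<lparr>carrier := H\<rparr>) n K" "subgroup H G" "i \<le> n"
  shows "hirsch_chain G {\<one>} (card {j. j < i \<and> infinite_cyclic_group (series_factor (G\<lparr>carrier := H\<rparr>) K j)}) (K i)"
  using assms(3)
proof (induction i)
  case 0
  then show ?case using assms(1) hirsch_chain.hc_refl[OF triv_subgroup]
    by (simp add: hirsch_series_def subnormal_series_def)
next
  case (Suc i)
  let ?C = "\<lambda>j. infinite_cyclic_group (series_factor (G\<lparr>carrier := H\<rparr>) K j)"
  have ser: "subnormal_series (G\<lparr>carrier := H\<rparr>) n K" using assms(1) by (simp add: hirsch_series_def)
  have sub: "subgroup (K (Suc i)) G" using subnormal_series_subgroup[OF ser assms(2) Suc.prems] .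
  have nor: "K i \<lhd> G\<lparr>carrier := K (Suc i)\<rparr>"
    using ser Suc.prems by (simp add: subnormal_series_def)
  then have rel: "K i \<subseteq> K (Suc i)" "normalizes G (K (Suc i)) (K i)"
    using normal_restrict_iff[OF sub] by auto
  have IH: "hirsch_chain G {\<one>} (card {j. j < i \<and> ?C j}) (K i)" using Suc by simp
  have fac: "series_factor (G\<lparr>carrier := H\<rparr>) K i = G\<lparr>carrier := K (Suc i)\<rparr> Mod K i"
    by (simp add: series_factor_def)
  show ?case
  proof (cases "?C i")
    case True
    then have "{j. j < Suc i \<and> ?C j} = insert i {j. j < i \<and> ?C j}" by (auto simp: less_Suc_eq)
    then have "card {j. j < Suc i \<and> ?C j} = Suc (card {j. j < i \<and> ?C j})" by simp
    then show ?thesis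
      using hirsch_chain.hc_cyclic[OF IH sub rel] True infinite_cyclic_factor_iff[OF sub nor] fac
      by simp
  next
    case False
    then have "{j. j < Suc i \<and> ?C j} = {j. j < i \<and> ?C j}" by (auto simp: less_Suc_eq)
    moreover have "periodic_group (series_factor (G\<lparr>carrier := H\<rparr>) K i)"
      using assms(1) False Suc_le_lessD[OF Suc.prems] by (auto simp: hirsch_series_def)
    ultimately show ?thesis
      using hirsch_chain.hc_periodic[OF IH sub rel] periodic_factor_iff[OF nor] fac by simp
  qed
qed

lemma hirsch_series_extend:
  assumes "hirsch_series (G\<lparr>carrier := Q\<rparr>) n K" "subgroup R G" "Q \<lhd> G\<lparr>carrier := R\<rparr>"
    and "periodic_mod G Q R \<or> infinite_cyclic_mod G Q R"
    and "s = card {i. i < n \<and> infinite_cyclic_group (series_factor (G\<lparr>carrier := Q\<rparr>) K i)} +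
      (if infinite_cyclic_mod G Q R then 1 else 0)"
  shows "\<exists>n K. hirsch_series (G\<lparr>carrier := R\<rparr>) n K \<and>
    s = card {i. i < n \<and> infinite_cyclic_group (series_factor (G\<lparr>carrier := R\<rparr>) K i)}"
proof -
  \<comment> \<open>The factor with index \<open>i\<close> depends on the terms \<open>i\<close> and
    \<open>Suc i\<close> alone. Hence all factors below \<open>n\<close> are kept, and the factor
    with index \<open>n\<close> becomes \<open>R/Q\<close> because \<open>K n = Q\<close>.\<close>
  define L where "L = K(Suc n := R)"
  let ?C = "\<lambda>i. infinite_cyclic_group (series_factor (G\<lparr>carrier := Q\<rparr>) K i)"
  let ?D = "\<lambda>i. infinite_cyclic_group (series_factor (G\<lparr>carrier := R\<rparr>) L i)"
  have K: "K 0 = {\<one>}" "K n = Q" "\<And>i. i < n \<Longrightarrow> K i \<lhd> G\<lparr>carrier := K (Suc i)\<rparr>"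
    using assms(1) by (auto simp: hirsch_series_def subnormal_series_def)
  have old: "series_factor (G\<lparr>carrier := R\<rparr>) L i = series_factor (G\<lparr>carrier := Q\<rparr>) K i" if "i < n" for i
    using that by (simp add: series_factor_def L_def)
  have new: "series_factor (G\<lparr>carrier := R\<rparr>) L n = G\<lparr>carrier := R\<rparr> Mod Q"
    by (simp add: series_factor_def L_def K)
  have "hirsch_series (G\<lparr>carrier := R\<rparr>) (Suc n) L"
    unfolding hirsch_series_def
  proof (intro conjI allI impI)
    show "subnormal_series (G\<lparr>carrier := R\<rparr>) (Suc n) L"
      using K assms(3) by (auto simp: subnormal_series_def L_def less_Suc_eq)
    show "periodic_group (series_factor (G\<lparr>carrier := R\<rparr>) L i) \<or> ?D i" if "i < Suc n" for i
      using that assms(1,4) old new periodic_factor_iff[OF assms(3)] infinite_cyclic_factor_iff[OF assms(2,3)]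
      by (auto simp: less_Suc_eq hirsch_series_def)
  qed
  moreover have "s = card {i. i < Suc n \<and> ?D i}"
  proof (cases "infinite_cyclic_mod G Q R")
    case True
    have "{i. i < Suc n \<and> ?D i} = insert n {i. i < n \<and> ?C i}"
      using old new True infinite_cyclic_factor_iff[OF assms(2,3)] by (auto simp: less_Suc_eq)
    then show ?thesis using assms(5) True by simp
  next
    case False
    have "{i. i < Suc n \<and> ?D i} = {i. i < n \<and> ?C i}"
      using old new False infinite_cyclic_factor_iff[OF assms(2,3)] by (auto simp: less_Suc_eq)
    then show ?thesis using assms(5) False by simp
  qed
  ultimately show ?thesis by blast
qed

lemma series_of_hirsch_chain:
  assumes "hirsch_chain G {\<one>} r H"
  shows "\<exists>n K. hirsch_series (G\<lparr>carrier := H\<rparr>) n K \<and>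
    r = card {i. i < n \<and> infinite_cyclic_group (series_factor (G\<lparr>carrier := H\<rparr>) K i)}"
  using assms
proof (induction rule: hirsch_chain.induct)
  case hc_refl
  have "hirsch_series (G\<lparr>carrier := {\<one>}\<rparr>) 0 (\<lambda>_. {\<one>})"
    by (simp add: hirsch_series_def subnormal_series_def)
  then show ?case by fastforce
next
  case (hc_periodic r Q R)
  have "Q \<lhd> G\<lparr>carrier := R\<rparr>"
    using normal_restrict_iff[OF hc_periodic(2)] hirsch_chain_subgroup[OF hc_periodic(1)] hc_periodic(3,4)
    by blast
  moreover have "\<not> infinite_cyclic_mod G Q R"
    using infinite_cyclic_mod_not_periodic hc_periodic(5) by blast
  moreover obtain n K where nK: "hirsch_series (G\<lparr>carrier := Q\<rparr>) n K"
    "r = card {i. i < n \<and> infinite_cyclic_group (series_factor (G\<lparr>carrier := Q\<rparr>) K i)}"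
    using hc_periodic.IH by blast
  ultimately show ?case
    using hirsch_series_extend[OF nK(1) hc_periodic(2)] hc_periodic(5) nK(2) by simp
next
  case (hc_cyclic r Q R)
  have "Q \<lhd> G\<lparr>carrier := R\<rparr>"
    using normal_restrict_iff[OF hc_cyclic(2)] hirsch_chain_subgroup[OF hc_cyclic(1)] hc_cyclic(3,4)
    by blast
  moreover obtain n K where nK: "hirsch_series (G\<lparr>carrier := Q\<rparr>) n K"
    "r = card {i. i < n \<and> infinite_cyclic_group (series_factor (G\<lparr>carrier := Q\<rparr>) K i)}"
    using hc_cyclic.IH by blast
  ultimately show ?case
    using hirsch_series_extend[OF nK(1) hc_cyclic(2)] hc_cyclic(5) nK(2) by simp
qed

text \<open>The definite description is justified here: the chain supplies a series, and any series
  turns back into a chain whose rank is determined.\<close>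

lemma hirsch_number_eq:
  assumes "hirsch_chain G {\<one>} r H"
  shows "hirsch_number (G\<lparr>carrier := H\<rparr>) = r"
  unfolding hirsch_number_def
proof (rule the_equality)
  show "\<exists>n K. hirsch_series (G\<lparr>carrier := H\<rparr>) n K \<and>
    r = card {i. i < n \<and> infinite_cyclic_group (series_factor (G\<lparr>carrier := H\<rparr>) K i)}"
    by (rule series_of_hirsch_chain[OF assms])
  fix s assume "\<exists>n K. hirsch_series (G\<lparr>carrier := H\<rparr>) n K \<and>
    s = card {i. i < n \<and> infinite_cyclic_group (series_factor (G\<lparr>carrier := H\<rparr>) K i)}"
  then obtain n K where nK: "hirsch_series (G\<lparr>carrier := H\<rparr>) n K"
    "s = card {i. i < n \<and> infinite_cyclic_group (series_factor (G\<lparr>carrier := H\<rparr>) K i)}" by blast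
  have "subgroup H G" using hirsch_chain_subgroup[OF assms] by blast
  from hirsch_chain_of_series[OF nK(1) this order_refl]
  have "hirsch_chain G {\<one>} s H" using nK by (simp add: hirsch_series_def subnormal_series_def)
  then show "s = r" using hirsch_chain_unique assms by blast
qed

text \<open>The quotient of \<open>R \<inter> H\<close> by \<open>N \<inter> H\<close> embeds into
  the infinite cyclic \<open>R/N\<close> with nontrivial image. As for subgroups of the integers,
  its generator belongs to the least positive exponent in the set \<open>J\<close> of those
  \<open>k\<close> for which the coset of \<open>g^k\<close> meets
  \<open>R \<inter> H\<close>.\<close>

lemma infinite_cyclic_mod_Int:
  assumes R: "subgroup R G" and N: "subgroup N G" and n: "normalizes G R N"
    and cyc: "infinite_cyclic_mod G N R" and H: "subgroup H G" and out: "\<not> R \<inter> H \<subseteq> N"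
  shows "infinite_cyclic_mod G (N \<inter> H) (R \<inter> H)"
proof -
  obtain g where g: "g \<in> R" and inf: "\<And>n::nat. 0 < n \<Longrightarrow> g [^] n \<notin> N"
    and gen: "\<And>x. x \<in> R \<Longrightarrow> \<exists>k::int. x \<otimes> inv (g [^] k) \<in> N"
    using cyc unfolding infinite_cyclic_mod_def by blast
  have gk: "g [^] i \<in> R" for i :: int using subgroup_int_pow_closed[OF R g] .
  have gc: "g \<in> carrier G" using g R by (simp add: subgroup.mem_carrier)
  have Rc: "x \<in> carrier G" if "x \<in> R" for x using that R by (simp add: subgroup.mem_carrier)
  define J where "J k \<longleftrightarrow> (\<exists>x\<in>R \<inter> H. x \<otimes> inv (g [^] k) \<in> N)" for k :: int
  have diff: "x \<otimes> inv (t [^] q) \<otimes> inv (g [^] (k - d * q)) \<in> N"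
    if x: "x \<in> R" "x \<otimes> inv (g [^] k) \<in> N" and t: "t \<in> R" "t \<otimes> inv (g [^] d) \<in> N" for x t and k d q :: int
  proof -
    define e where "e = k - d * q"
    have "t [^] q \<otimes> inv ((g [^] d) [^] q) \<in> N" using int_pow_cong_mod[OF R N n t(1) gk t(2)] .
    then have "inv (t [^] q \<otimes> inv (g [^] (d * q))) \<in> N"
      using N gc by (simp add: int_pow_pow subgroup.m_inv_closed)
    then have v: "g [^] (d * q) \<otimes> inv (t [^] q) \<in> N" using gc Rc[OF t(1)] by (simp add: inv_mult_group)
    have gk_eq: "g [^] k = g [^] e \<otimes> g [^] (d * q)"
      using int_pow_mult[OF gc, of e "d * q"] by (simp add: e_def)
    have "x \<otimes> inv (t [^] q) \<otimes> inv (g [^] e) =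
      (x \<otimes> inv (g [^] k)) \<otimes> (g [^] e \<otimes> (g [^] (d * q) \<otimes> inv (t [^] q)) \<otimes> inv (g [^] e))"
      unfolding gk_eq using gc Rc[OF t(1)] Rc[OF x(1)] by (simp add: m_assoc inv_mult_group)
    then show ?thesis
      using x(2) normalizesD[OF n gk[of e] v] N by (simp add: e_def subgroup.m_closed)
  qed
  have RH: "subgroup (R \<inter> H) G" using subgroups_Inter_pair[OF R H] .
  have Jdiff: "J (k - d * q)" if J: "J k" "J d" for k d q
  proof -
    obtain x where x: "x \<in> R \<inter> H" "x \<otimes> inv (g [^] k) \<in> N" using J(1) unfolding J_def by blast
    obtain t where t: "t \<in> R \<inter> H" "t \<otimes> inv (g [^] d) \<in> N" using J(2) unfolding J_def by blast
    have "x \<otimes> inv (t [^] q) \<in> R \<inter> H"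
      by (rule subgroup_mult_inv_closed[OF RH x(1) subgroup_int_pow_closed[OF RH t(1)]])
    then show ?thesis using diff[of x k t d q] x t unfolding J_def by blast
  qed
  obtain x0 where x0: "x0 \<in> R \<inter> H" "x0 \<notin> N" using out by blast
  obtain k0 :: int where k0: "x0 \<otimes> inv (g [^] k0) \<in> N" using gen x0 by blast
  have "k0 \<noteq> 0" using k0 x0 Rc by (metis IntD1 int_pow_0 inv_one r_one)
  have "J k0" using x0 k0 unfolding J_def by blast
  \<comment> \<open>\<open>J\<close> is only known to be closed under \<open>k - d * q\<close>.
    Taking \<open>k = d = k0\<close> and \<open>q = 2\<close> gives \<open>- k0\<close>, so
    \<open>J\<close> has a positive member whatever the sign of \<open>k0\<close>.\<close>
  then have "J (k0 - k0 * 2)" "J (- k0)" using Jdiff[of k0 k0 2] by simp_all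
  with \<open>J k0\<close> have "J (int (nat \<bar>k0\<bar>))" by (cases "k0 > 0") auto
  then have ex: "\<exists>m::nat. 0 < m \<and> J (int m)" using \<open>k0 \<noteq> 0\<close> by (intro exI[of _ "nat \<bar>k0\<bar>"]) auto
  define d where "d = (LEAST m::nat. 0 < m \<and> J (int m))"
  have d: "0 < d" "J (int d)" using LeastI_ex[OF ex] by (auto simp: d_def)
  have dmin: "d \<le> m" if "0 < m" "J (int m)" for m using that unfolding d_def by (intro Least_le) auto
  obtain t where t: "t \<in> R \<inter> H" "t \<otimes> inv (g [^] int d) \<in> N" using d(2) unfolding J_def by blast
  have tc: "t \<in> carrier G" using t(1) Rc by blast
  have "t [^] m \<notin> N" if "0 < m" for m :: nat
  proof
    assume tm: "t [^] m \<in> N"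
    have "t [^] m \<otimes> inv ((g [^] int d) [^] m) \<in> N"
      using nat_pow_cong_mod[OF R N n _ gk t(2)] t(1) by blast
    then have "inv (t [^] m) \<otimes> (t [^] m \<otimes> inv ((g [^] int d) [^] m)) \<in> N"
      using tm N by (simp add: subgroup.m_closed subgroup.m_inv_closed)
    then have "inv (g [^] (d * m)) \<in> N" using tc gc by (simp add: int_pow_int nat_pow_pow)
    then have "g [^] (d * m) \<in> N" using gc N by (metis inv_inv nat_pow_closed subgroup.m_inv_closed)
    then show False using inf[of "d * m"] that d(1) by simp
  qed
  moreover have "\<exists>k::int. x \<otimes> inv (t [^] k) \<in> N \<inter> H" if x: "x \<in> R \<inter> H" for x
  proof -
    obtain k :: int where k: "x \<otimes> inv (g [^] k) \<in> N" using gen x by blast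
    then have "J k" using x k unfolding J_def by blast
    then have J: "J (k mod int d)" using Jdiff[of k "int d" "k div int d"] d by (simp add: minus_mult_div_eq_mod)
    have z: "k mod int d = 0"
    proof (rule ccontr)
      assume "k mod int d \<noteq> 0"
      moreover have "0 \<le> k mod int d" "k mod int d < int d" using d(1) by simp_all
      ultimately show False using dmin[of "nat (k mod int d)"] J by simp
    qed
    have "x \<otimes> inv (t [^] (k div int d)) \<otimes> inv (g [^] (k - int d * (k div int d))) \<in> N"
      using diff[of x k t "int d" "k div int d"] x t k by blast
    then have "x \<otimes> inv (t [^] (k div int d)) \<in> N"
      using z x t(1) Rc tc by (simp add: minus_mult_div_eq_mod)
    moreover have "x \<otimes> inv (t [^] (k div int d)) \<in> H"
      using subgroup_mult_inv_closed[OF H _ subgroup_int_pow_closed[OF H]] x t(1) by blast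
    ultimately show ?thesis by blast
  qed
  ultimately show ?thesis using t(1) unfolding infinite_cyclic_mod_def by blast
qed

text \<open>A periodic step stays periodic. An infinite cyclic step either stays infinite cyclic or
  collapses to equality, and then it is left out. This gives every subgroup a Hirsch number of its
  own, with a value not tied to that of \<open>G\<close>.\<close>

lemma hirsch_chain_Int:
  assumes "hirsch_chain G {\<one>} r Q" "subgroup H G"
  shows "\<exists>s. hirsch_chain G {\<one>} s (Q \<inter> H)"
  using assms(1)
proof (induction rule: hirsch_chain.induct)
  case hc_refl
  have "{\<one>} \<inter> H = {\<one>}" using assms(2) by (auto simp: subgroup.one_closed)
  then show ?case using hirsch_chain.hc_refl[OF hc_refl] by auto
next
  case (hc_periodic r Q R)
  then obtain s where s: "hirsch_chain G {\<one>} s (Q \<inter> H)" by blast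
  have "periodic_mod G (Q \<inter> H) (R \<inter> H)"
    using hc_periodic(5) subgroup_nat_pow_closed[OF assms(2)] unfolding periodic_mod_def by blast
  moreover have "Q \<inter> H \<subseteq> R \<inter> H" using hc_periodic(3) by blast
  ultimately show ?case
    using hirsch_chain.hc_periodic[OF s subgroups_Inter_pair[OF hc_periodic(2) assms(2)] _
        normalizes_Int[OF assms(2) hc_periodic(4)]] by metis
next
  case (hc_cyclic r Q R)
  then obtain s where s: "hirsch_chain G {\<one>} s (Q \<inter> H)" by blast
  have le: "Q \<inter> H \<subseteq> R \<inter> H" using hc_cyclic(3) by blast
  have sQ: "subgroup Q G" using hirsch_chain_subgroup[OF hc_cyclic(1)] by blast
  show ?case
  proof (cases "R \<inter> H \<subseteq> Q")
    case True
    then have "R \<inter> H = Q \<inter> H" using le by blast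
    then show ?thesis using s by auto
  next
    case False
    show ?thesis
      using hirsch_chain.hc_cyclic[OF s subgroups_Inter_pair[OF hc_cyclic(2) assms(2)] le
        normalizes_Int[OF assms(2) hc_cyclic(4)]
        infinite_cyclic_mod_Int[OF hc_cyclic(2) sQ hc_cyclic(4,5) assms(2) False]] by blast
  qed
qed

end

context group_hom
begin

lemma subgroup_vimage: "subgroup S H \<Longrightarrow> subgroup (h -` S \<inter> carrier G) G"
  by (rule subgroup.intro) (auto simp: subgroup.one_closed subgroup.m_closed subgroup.m_inv_closed)

text \<open>Surjectivity lifts the generators of the infinite cyclic steps. For the projection onto
  a factor group this converts a chain of sets of cosets into a chain of subgroups of the original
  group.\<close>

lemma hirsch_chain_vimage:
  assumes "hirsch_chain H P r Q" "carrier H \<subseteq> h ` carrier G"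
  shows "hirsch_chain G (h -` P \<inter> carrier G) r (h -` Q \<inter> carrier G)"
  using assms(1)
proof (induction rule: hirsch_chain.induct)
  case hc_refl
  then show ?case by (intro hirsch_chain.hc_refl subgroup_vimage)
next
  case (hc_periodic r Q R)
  have "normalizes G (h -` R \<inter> carrier G) (h -` Q \<inter> carrier G)"
    using hc_periodic(4) by (auto simp: normalizes_def)
  moreover have "periodic_mod G (h -` Q \<inter> carrier G) (h -` R \<inter> carrier G)"
    using hc_periodic(5) by (auto simp: periodic_mod_def hom_nat_pow)
  moreover have "h -` Q \<inter> carrier G \<subseteq> h -` R \<inter> carrier G" using hc_periodic(3) by blast
  ultimately show ?case
    using hirsch_chain.hc_periodic[OF hc_periodic.IH subgroup_vimage[OF hc_periodic(2)]] by blast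
next
  case (hc_cyclic r Q R)
  have "normalizes G (h -` R \<inter> carrier G) (h -` Q \<inter> carrier G)"
    using hc_cyclic(4) by (auto simp: normalizes_def)
  moreover have "infinite_cyclic_mod G (h -` Q \<inter> carrier G) (h -` R \<inter> carrier G)"
  proof -
    obtain t where t: "t \<in> R" "\<And>n::nat. 0 < n \<Longrightarrow> t [^]\<^bsub>H\<^esub> n \<notin> Q"
      "\<And>x. x \<in> R \<Longrightarrow> \<exists>k::int. x \<otimes>\<^bsub>H\<^esub> inv\<^bsub>H\<^esub> (t [^]\<^bsub>H\<^esub> k) \<in> Q"
      using hc_cyclic(5) unfolding infinite_cyclic_mod_def by blast
    obtain u where u: "u \<in> carrier G" "t = h u"
      using t(1) assms(2) subgroup.subset[OF hc_cyclic(2)] by blast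
    have "u [^] n \<notin> h -` Q \<inter> carrier G" if "0 < n" for n :: nat
      using t(2)[OF that] u by (simp add: hom_nat_pow)
    moreover have "\<exists>k::int. x \<otimes> inv (u [^] k) \<in> h -` Q \<inter> carrier G" if x: "x \<in> h -` R \<inter> carrier G" for x
      using t(3)[of "h x"] x u by (auto simp: hom_int_pow)
    ultimately show ?thesis using u t(1) unfolding infinite_cyclic_mod_def by blast
  qed
  moreover have "h -` Q \<inter> carrier G \<subseteq> h -` R \<inter> carrier G" using hc_cyclic(3) by blast
  ultimately show ?case
    using hirsch_chain.hc_cyclic[OF hc_cyclic.IH subgroup_vimage[OF hc_cyclic(2)]] by blast
qed

end

lemma (in group) hirsch_chain_carrier:
  assumes "finite_torsion_free_rank G"
  shows "\<exists>r. hirsch_chain G {\<one>} r (carrier G)"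
proof -
  obtain n K where nK: "hirsch_series G n K" using assms by (auto simp: finite_torsion_free_rank_def)
  then have "hirsch_series (G\<lparr>carrier := carrier G\<rparr>) n K" by simp
  from hirsch_chain_of_series[OF this subgroup_self order_refl]
  show ?thesis using nK by (auto simp: hirsch_series_def subnormal_series_def)
qed

lemma (in group) hirsch_chain_factor:
  assumes "subgroup R G" "N \<lhd> G\<lparr>carrier := R\<rparr>" "finite_torsion_free_rank (G\<lparr>carrier := R\<rparr> Mod N)"
  shows "\<exists>r. hirsch_chain G N r R"
proof -
  interpret N: normal N "G\<lparr>carrier := R\<rparr>" by fact
  interpret h: group_hom "G\<lparr>carrier := R\<rparr>" "G\<lparr>carrier := R\<rparr> Mod N" "\<lambda>a. N #>\<^bsub>G\<lparr>carrier := R\<rparr>\<^esub> a"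
    by (rule N.group_hom_r_coset)
  obtain r where r: "hirsch_chain (G\<lparr>carrier := R\<rparr> Mod N) {\<one>\<^bsub>G\<lparr>carrier := R\<rparr> Mod N\<^esub>} r (carrier (G\<lparr>carrier := R\<rparr> Mod N))"
    using h.H.hirsch_chain_carrier[OF assms(3)] by blast
  have "(\<lambda>a. N #>\<^bsub>G\<lparr>carrier := R\<rparr>\<^esub> a) -` {\<one>\<^bsub>G\<lparr>carrier := R\<rparr> Mod N\<^esub>} \<inter> carrier (G\<lparr>carrier := R\<rparr>) = N"
    using N.r_coset_eq_self_iff N.subset by auto
  moreover have "(\<lambda>a. N #>\<^bsub>G\<lparr>carrier := R\<rparr>\<^esub> a) -` carrier (G\<lparr>carrier := R\<rparr> Mod N) \<inter> carrier (G\<lparr>carrier := R\<rparr>) = R"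
    by (auto simp: carrier_FactGroup)
  moreover have "carrier (G\<lparr>carrier := R\<rparr> Mod N) \<subseteq> (\<lambda>a. N #>\<^bsub>G\<lparr>carrier := R\<rparr>\<^esub> a) ` carrier (G\<lparr>carrier := R\<rparr>)"
    by (simp add: carrier_FactGroup)
  ultimately have "hirsch_chain (G\<lparr>carrier := R\<rparr>) N r R"
    using h.hirsch_chain_vimage[OF r] by metis
  then show ?thesis using hirsch_chain_restrict assms(1) by blast
qed

section \<open>Subgroups of finite index and sections of finite exponent\<close>

text \<open>\<open>T\<close> need not lie in \<open>S\<close>, and the representatives may be taken
  anywhere in \<open>G\<close>. This makes the notion monotone in both arguments; representatives
  inside \<open>S\<close> can be recovered when \<open>T\<close> is a subgroup.\<close>

definition fin_index :: "('a, 'b) monoid_scheme \<Rightarrow> 'a set \<Rightarrow> 'a set \<Rightarrow> bool" where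
  "fin_index G S T \<longleftrightarrow>
     (\<exists>F. finite F \<and> F \<subseteq> carrier G \<and> (\<forall>s\<in>S. \<exists>f\<in>F. s \<otimes>\<^bsub>G\<^esub> inv\<^bsub>G\<^esub> f \<in> T))"

text \<open>The condition \<open>S \<inter> P \<subseteq> T\<close>, weaker than \<open>P \<subseteq> T\<close>, spares passing from \<open>S\<close> and \<open>T\<close> to their
  products with \<open>Q\<close> in the proof of transitivity.\<close>

definition bounded_sections_finite :: "('a, 'b) monoid_scheme \<Rightarrow> 'a set \<Rightarrow> 'a set \<Rightarrow> bool" where
  "bounded_sections_finite G P Q \<longleftrightarrow>
     (\<forall>S T e. subgroup S G \<longrightarrow> subgroup T G \<longrightarrow> T \<subseteq> S \<longrightarrow> S \<subseteq> Q \<longrightarrow> S \<inter> P \<subseteq> T \<longrightarrow> 0 < e \<longrightarrow>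
        (\<forall>x\<in>S. \<forall>y\<in>S. x \<otimes>\<^bsub>G\<^esub> y \<otimes>\<^bsub>G\<^esub> inv\<^bsub>G\<^esub> x \<otimes>\<^bsub>G\<^esub> inv\<^bsub>G\<^esub> y \<in> T) \<longrightarrow>
        (\<forall>x\<in>S. x [^]\<^bsub>G\<^esub> (e::nat) \<in> T) \<longrightarrow> fin_index G S T)"

lemma fin_index_mono: "fin_index G S T \<Longrightarrow> S' \<subseteq> S \<Longrightarrow> T \<subseteq> T' \<Longrightarrow> fin_index G S' T'"
  unfolding fin_index_def by (meson subsetD)

lemma bounded_sections_finiteI:
  assumes "\<And>S T e. subgroup S G \<Longrightarrow> subgroup T G \<Longrightarrow> T \<subseteq> S \<Longrightarrow> S \<subseteq> Q \<Longrightarrow> S \<inter> P \<subseteq> T \<Longrightarrow> 0 < e \<Longrightarrow>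
    (\<And>x y. x \<in> S \<Longrightarrow> y \<in> S \<Longrightarrow> x \<otimes>\<^bsub>G\<^esub> y \<otimes>\<^bsub>G\<^esub> inv\<^bsub>G\<^esub> x \<otimes>\<^bsub>G\<^esub> inv\<^bsub>G\<^esub> y \<in> T) \<Longrightarrow>
    (\<And>x. x \<in> S \<Longrightarrow> x [^]\<^bsub>G\<^esub> (e::nat) \<in> T) \<Longrightarrow> fin_index G S T"
  shows "bounded_sections_finite G P Q"
  unfolding bounded_sections_finite_def by (intro allI impI assms) blast+

lemma bounded_sections_finiteD:
  assumes "bounded_sections_finite G P Q"
    and "subgroup S G" "subgroup T G" "T \<subseteq> S" "S \<subseteq> Q" "S \<inter> P \<subseteq> T" "0 < e"
    and "\<And>x y. x \<in> S \<Longrightarrow> y \<in> S \<Longrightarrow> x \<otimes>\<^bsub>G\<^esub> y \<otimes>\<^bsub>G\<^esub> inv\<^bsub>G\<^esub> x \<otimes>\<^bsub>G\<^esub> inv\<^bsub>G\<^esub> y \<in> T"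
    and "\<And>x. x \<in> S \<Longrightarrow> x [^]\<^bsub>G\<^esub> (e::nat) \<in> T"
  shows "fin_index G S T"
  using assms unfolding bounded_sections_finite_def by blast

context group
begin

lemma fin_index_subset:
  assumes "S \<subseteq> T" "S \<subseteq> carrier G"
  shows "fin_index G S T"
  unfolding fin_index_def
  using assms by (intro exI[of _ "{\<one>}"]) (auto simp: subset_iff)

text \<open>Each representative whose coset meets \<open>S\<close> is exchanged for an element of
  \<open>S\<close> in that coset; the others are discarded.\<close>

lemma fin_index_representatives:
  assumes "fin_index G S T" "subgroup T G" "S \<subseteq> carrier G"
  obtains F where "finite F" "F \<subseteq> S" "\<And>s. s \<in> S \<Longrightarrow> \<exists>f\<in>F. s \<otimes> inv f \<in> T"
proof -
  obtain E where E: "finite E" "E \<subseteq> carrier G" "\<And>s. s \<in> S \<Longrightarrow> \<exists>f\<in>E. s \<otimes> inv f \<in> T"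
    using assms(1) unfolding fin_index_def by blast
  define E' where "E' = {f \<in> E. \<exists>s\<in>S. s \<otimes> inv f \<in> T}"
  define r where "r f = (SOME s. s \<in> S \<and> s \<otimes> inv f \<in> T)" for f
  have r: "r f \<in> S \<and> r f \<otimes> inv f \<in> T" if "f \<in> E'" for f
    using that someI_ex[of "\<lambda>s. s \<in> S \<and> s \<otimes> inv f \<in> T"] unfolding r_def E'_def by blast
  show thesis
  proof (rule that)
    show "finite (r ` E')" using E(1) by (simp add: E'_def)
    show "r ` E' \<subseteq> S" using r by blast
    fix s assume s: "s \<in> S"
    then obtain f where f: "f \<in> E" "s \<otimes> inv f \<in> T" using E(3) by blast
    then have f': "f \<in> E'" using s by (auto simp: E'_def)
    have c: "s \<in> carrier G" "f \<in> carrier G" "r f \<in> carrier G"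
      using s f(1) E(2) r[OF f'] assms(3) by auto
    have "(s \<otimes> inv f) \<otimes> inv (r f \<otimes> inv f) \<in> T"
      using subgroup_mult_inv_closed[OF assms(2) f(2)] r[OF f'] by blast
    then have "s \<otimes> inv (r f) \<in> T" using c by (simp add: inv_mult_group m_assoc)
    then show "\<exists>f\<in>r ` E'. s \<otimes> inv f \<in> T" using f' by blast
  qed
qed

lemma fin_index_trans:
  assumes "fin_index G S T" "fin_index G T U" "subgroup U G" "S \<subseteq> carrier G" "T \<subseteq> carrier G"
  shows "fin_index G S U"
proof -
  obtain E where E: "finite E" "E \<subseteq> carrier G" "\<And>s. s \<in> S \<Longrightarrow> \<exists>f\<in>E. s \<otimes> inv f \<in> T"
    using assms(1) unfolding fin_index_def by blast
  obtain F where F: "finite F" "F \<subseteq> carrier G" "\<And>s. s \<in> T \<Longrightarrow> \<exists>f\<in>F. s \<otimes> inv f \<in> U"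
    using assms(2) unfolding fin_index_def by blast
  have "\<exists>h\<in>F <#> E. s \<otimes> inv h \<in> U" if s: "s \<in> S" for s
  proof -
    obtain f where f: "f \<in> E" "s \<otimes> inv f \<in> T" using E(3) s by blast
    obtain h where h: "h \<in> F" "(s \<otimes> inv f) \<otimes> inv h \<in> U" using F(3) f by blast
    have "s \<in> carrier G" "f \<in> carrier G" "h \<in> carrier G" using s f h E F assms by auto
    then have "s \<otimes> inv (h \<otimes> f) \<in> U" using h(2) by (simp add: inv_mult_group m_assoc)
    then show ?thesis using f(1) h(1) by (auto simp: set_mult_def)
  qed
  moreover have "finite (F <#> E)" using E(1) F(1) by (simp add: set_mult_def)
  moreover have "F <#> E \<subseteq> carrier G" using E(2) F(2) by (auto simp: set_mult_def)
  ultimately show ?thesis unfolding fin_index_def by blast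
qed

lemma fin_index_iff_finite_rcosets:
  assumes "subgroup H G"
  shows "fin_index G (carrier G) H \<longleftrightarrow> finite (rcosets H)"
proof
  assume "fin_index G (carrier G) H"
  then obtain F where F: "finite F" "F \<subseteq> carrier G" "\<And>s. s \<in> carrier G \<Longrightarrow> \<exists>f\<in>F. s \<otimes> inv f \<in> H"
    unfolding fin_index_def by blast
  have "rcosets H \<subseteq> (\<lambda>f. H #> f) ` F"
  proof
    fix C assume "C \<in> rcosets H"
    then obtain a where a: "a \<in> carrier G" "C = H #> a" by (auto simp: RCOSETS_def)
    then obtain f where f: "f \<in> F" "a \<otimes> inv f \<in> H" using F(3) by blast
    have "a = (a \<otimes> inv f) \<otimes> f" using a f F(2) by (auto simp: m_assoc)
    then have "a \<in> H #> f" using f(2) unfolding r_coset_def by blast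
    moreover have "f \<in> carrier G" using f(1) F(2) by blast
    ultimately have "H #> f = H #> a" using repr_independence assms by metis
    then show "C \<in> (\<lambda>f. H #> f) ` F" using a(2) f(1) by blast
  qed
  then show "finite (rcosets H)" using F(1) finite_subset by blast
next
  assume fin: "finite (rcosets H)"
  define r where "r C = (SOME a. a \<in> C)" for C :: "'a set"
  have r: "r C \<in> C" if "C \<in> rcosets H" for C
    using subgroup.rcosets_non_empty[OF assms that] unfolding r_def by (simp add: some_in_eq)
  have "r ` (rcosets H) \<subseteq> carrier G" using r rcosets_subset_PowG[OF assms] by blast
  moreover have "\<exists>f\<in>r ` (rcosets H). s \<otimes> inv f \<in> H" if s: "s \<in> carrier G" for s
  proof -
    have C: "H #> s \<in> rcosets H" using s by (auto simp: RCOSETS_def)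
    then obtain h where h: "h \<in> H" "r (H #> s) = h \<otimes> s" using r[OF C] by (auto simp: r_coset_def)
    have "h \<in> carrier G" using h(1) assms by (simp add: subgroup.mem_carrier)
    then have "s \<otimes> inv (r (H #> s)) = inv h" using s h(2) by (simp add: inv_mult_group)
    then have "s \<otimes> inv (r (H #> s)) \<in> H" using subgroup.m_inv_closed[OF assms h(1)] by simp
    then show ?thesis using C by blast
  qed
  ultimately show "fin_index G (carrier G) H"
    using fin unfolding fin_index_def by (intro exI[of _ "r ` (rcosets H)"]) auto
qed

text \<open>By the pigeonhole principle two powers of \<open>x\<close> lie in the same right coset
  of \<open>H\<close>, and their quotient is a positive power in \<open>H\<close>. Normality of
  \<open>H\<close> does not enter.\<close>

lemma fin_index_periodic_mod:
  assumes H: "subgroup H G" and "fin_index G (carrier G) H"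
  shows "periodic_mod G H (carrier G)"
  unfolding periodic_mod_def
proof
  fix x assume x: "x \<in> carrier G"
  obtain F where F: "finite F" "F \<subseteq> carrier G" "\<And>s. s \<in> carrier G \<Longrightarrow> \<exists>f\<in>F. s \<otimes> inv f \<in> H"
    using assms(2) unfolding fin_index_def by blast
  have "\<exists>f\<in>F. x [^] (n::nat) \<otimes> inv f \<in> H" for n using F(3) x by simp
  then obtain r where r: "\<And>n. r n \<in> F" "\<And>n::nat. x [^] n \<otimes> inv (r n) \<in> H" by metis
  have "\<not> inj r"
    using F(1) r(1) by (metis finite_subset image_subsetI infinite_UNIV_nat range_inj_infinite)
  then obtain m n where mn: "m < n" "r m = r n"
    unfolding inj_def by (metis linorder_neqE_nat)
  have c: "r n \<in> carrier G" using r(1) F(2) by blast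
  have "(x [^] n \<otimes> inv (r n)) \<otimes> inv (x [^] m \<otimes> inv (r n)) \<in> H"
    using subgroup_mult_inv_closed[OF H r(2)[of n]] r(2)[of m] mn(2) by simp
  then have "x [^] n \<otimes> inv (x [^] m) \<in> H" using c x by (simp add: inv_mult_group m_assoc)
  moreover have "x [^] n = x [^] (n - m) \<otimes> x [^] m" using x mn(1) by (simp add: nat_pow_mult)
  ultimately have "x [^] (n - m) \<in> H" using x by (simp add: m_assoc)
  then show "\<exists>n::nat. 0 < n \<and> x [^] n \<in> H" using mn(1) by (intro exI[of _ "n - m"]) simp
qed

section \<open>Closure properties of the finiteness of bounded sections\<close>

lemma bounded_sections_finite_refl: "bounded_sections_finite G P P"
proof (rule bounded_sections_finiteI)
  fix S T assume "subgroup S G" "S \<subseteq> P" "S \<inter> P \<subseteq> T"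
  then show "fin_index G S T" by (intro fin_index_subset) (auto simp: subgroup.subset)
qed

text \<open>The intermediate group \<open>T' = T <#> (S \<inter> Q)\<close> separates the two
  hypotheses. The pair \<open>S\<close>, \<open>T'\<close> falls under the one from \<open>Q\<close>
  to \<open>R\<close>, because \<open>S \<inter> Q \<subseteq> T'\<close>; the index of
  \<open>T\<close> in \<open>T'\<close> is governed by \<open>S \<inter> Q\<close> and
  \<open>T \<inter> Q\<close>, which fall under the one from \<open>P\<close> to
  \<open>Q\<close>.\<close>

lemma bounded_sections_finite_trans:
  assumes PQ: "bounded_sections_finite G P Q" and QR: "bounded_sections_finite G Q R"
    and Q: "subgroup Q G" and n: "normalizes G R Q" and "P \<subseteq> Q"
  shows "bounded_sections_finite G P R"
proof (rule bounded_sections_finiteI)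
  fix S T and e :: nat
  assume S: "subgroup S G" and T: "subgroup T G" and TS: "T \<subseteq> S" and SR: "S \<subseteq> R"
    and SP: "S \<inter> P \<subseteq> T" and e: "0 < e"
    and comm: "\<And>x y. x \<in> S \<Longrightarrow> y \<in> S \<Longrightarrow> x \<otimes> y \<otimes> inv x \<otimes> inv y \<in> T"
    and pow: "\<And>x. x \<in> S \<Longrightarrow> x [^] e \<in> T"
  have SQ: "subgroup (S \<inter> Q) G" and TQ: "subgroup (T \<inter> Q) G"
    using subgroups_Inter_pair S T Q by auto
  have "normalizes G (S \<inter> S) (Q \<inter> S)" using normalizes_Int[OF S normalizes_subset[OF n SR]] .
  then have nT: "normalizes G T (S \<inter> Q)"
    using normalizes_subset[OF _ TS] by (simp add: Int_commute)
  define T' where "T' = T <#> (S \<inter> Q)"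
  have T': "subgroup T' G" unfolding T'_def using subgroup_set_mult[OF T SQ nT] .
  have TT': "T \<subseteq> T'" "S \<inter> Q \<subseteq> T'" "T' \<subseteq> S"
    using set_mult_supset[OF T SQ] set_mult_least[OF S TS] unfolding T'_def by auto
  have "fin_index G S T'"
    by (rule bounded_sections_finiteD[OF QR S T' TT'(3) SR TT'(2) e]) (use comm pow TT'(1) in auto)
  moreover have "fin_index G (S \<inter> Q) (T \<inter> Q)"
  proof (rule bounded_sections_finiteD[OF PQ SQ TQ _ _ _ e])
    show "T \<inter> Q \<subseteq> S \<inter> Q" "S \<inter> Q \<subseteq> Q" "S \<inter> Q \<inter> P \<subseteq> T \<inter> Q" using TS SP by auto
    show "x \<otimes> y \<otimes> inv x \<otimes> inv y \<in> T \<inter> Q" if "x \<in> S \<inter> Q" "y \<in> S \<inter> Q" for x y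
      using that comm Q by (simp add: subgroup.m_closed subgroup.m_inv_closed)
    show "x [^] e \<in> T \<inter> Q" if "x \<in> S \<inter> Q" for x
      using that pow subgroup_nat_pow_closed[OF Q] by blast
  qed
  \<comment> \<open>In \<open>s = t a\<close> the factor \<open>t\<close> is absorbed by
    \<open>T\<close>, so representatives for \<open>a\<close> also serve for
    \<open>s\<close>.\<close>
  then have "fin_index G T' T"
    unfolding fin_index_def
  proof (elim exE conjE, intro exI conjI ballI)
    fix F s assume F: "finite F" "F \<subseteq> carrier G" "\<forall>s\<in>S \<inter> Q. \<exists>f\<in>F. s \<otimes> inv f \<in> T \<inter> Q" and "s \<in> T'"
    then obtain t a where ta: "t \<in> T" "a \<in> S \<inter> Q" "s = t \<otimes> a" by (auto simp: T'_def set_mult_def)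
    then obtain f where f: "f \<in> F" "a \<otimes> inv f \<in> T" using F(3) by blast
    have "t \<in> carrier G" "a \<in> carrier G" "f \<in> carrier G"
      using ta f(1) F(2) T S by (auto simp: subgroup.mem_carrier)
    then have "s \<otimes> inv f = t \<otimes> (a \<otimes> inv f)" using ta(3) by (simp add: m_assoc)
    then have "s \<otimes> inv f \<in> T" using subgroup.m_closed[OF T ta(1) f(2)] by simp
    then show "\<exists>f\<in>F. s \<otimes> inv f \<in> T" using f(1) by blast
  qed
  ultimately show "fin_index G S T"
    using fin_index_trans[OF _ _ T] subgroup.subset[OF S] subgroup.subset[OF T'] by blast
qed

lemma fin_index_restrict:
  assumes "subgroup R G" "fin_index (G\<lparr>carrier := R\<rparr>) S T"
  shows "fin_index G S T"
proof -
  obtain F where F: "finite F" "F \<subseteq> R" "\<forall>s\<in>S. \<exists>f\<in>F. s \<otimes> inv\<^bsub>G\<lparr>carrier := R\<rparr>\<^esub> f \<in> T"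
    using assms(2) unfolding fin_index_def by auto
  have "inv\<^bsub>G\<lparr>carrier := R\<rparr>\<^esub> f = inv f" if "f \<in> F" for f
    using that F(2) assms(1) by auto
  then show ?thesis
    using F subgroup.subset[OF assms(1)] unfolding fin_index_def by (intro exI[of _ F]) auto
qed

lemma bounded_sections_finite_restrict:
  assumes R: "subgroup R G" and b: "bounded_sections_finite (G\<lparr>carrier := R\<rparr>) P Q" and "Q \<subseteq> R"
  shows "bounded_sections_finite G P Q"
proof (rule bounded_sections_finiteI)
  fix S T and e :: nat
  assume S: "subgroup S G" and T: "subgroup T G" and TS: "T \<subseteq> S" and SQ: "S \<subseteq> Q"
    and SP: "S \<inter> P \<subseteq> T" and e: "0 < e"
    and comm: "\<And>x y. x \<in> S \<Longrightarrow> y \<in> S \<Longrightarrow> x \<otimes> y \<otimes> inv x \<otimes> inv y \<in> T"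
    and pow: "\<And>x. x \<in> S \<Longrightarrow> x [^] e \<in> T"
  have SR: "S \<subseteq> R" using SQ assms(3) by blast
  have "fin_index (G\<lparr>carrier := R\<rparr>) S T"
  proof (rule bounded_sections_finiteD[OF b subgroup_incl[OF S R SR] subgroup_incl[OF T R] TS SQ SP e])
    show "T \<subseteq> R" using TS SR by blast
    show "x \<otimes>\<^bsub>G\<lparr>carrier := R\<rparr>\<^esub> y \<otimes>\<^bsub>G\<lparr>carrier := R\<rparr>\<^esub> inv\<^bsub>G\<lparr>carrier := R\<rparr>\<^esub> x \<otimes>\<^bsub>G\<lparr>carrier := R\<rparr>\<^esub> inv\<^bsub>G\<lparr>carrier := R\<rparr>\<^esub> y \<in> T"
      if "x \<in> S" "y \<in> S" for x y
    proof -
      have "x \<in> R" "y \<in> R" using that SR by auto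
      then show ?thesis using comm[OF that] R by simp
    qed
    show "x [^]\<^bsub>G\<lparr>carrier := R\<rparr>\<^esub> e \<in> T" if "x \<in> S" for x
      using pow[OF that] by (simp flip: nat_pow_consistent)
  qed
  then show "fin_index G S T" by (rule fin_index_restrict[OF R])
qed

text \<open>As soon as \<open>S\<close> contains some \<open>t^k\<close> other than the identity,
  \<open>T\<close> contains \<open>t^(k e)\<close>, and the powers of \<open>t\<close> below
  \<open>N = |k e|\<close> represent all cosets. The trivial \<open>S\<close> is set apart to ensure
  that \<open>N\<close> is positive.\<close>

lemma bounded_sections_finite_cyclic:
  assumes t: "t \<in> carrier G" and gen: "\<And>x. x \<in> carrier G \<Longrightarrow> \<exists>k::int. x = t [^] k"
  shows "bounded_sections_finite G {\<one>} (carrier G)"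
proof (rule bounded_sections_finiteI)
  fix S T and e :: nat
  assume S: "subgroup S G" and T: "subgroup T G" and e: "0 < e" and pow: "\<And>x. x \<in> S \<Longrightarrow> x [^] e \<in> T"
  show "fin_index G S T"
  proof (cases "S = {\<one>}")
    case True
    then show ?thesis using subgroup.one_closed[OF T] by (intro fin_index_subset) auto
  next
    case False
    then obtain s where s: "s \<in> S" "s \<noteq> \<one>" using subgroup.one_closed[OF S] by blast
    then obtain k :: int where k: "s = t [^] k" using gen subgroup.mem_carrier[OF S] by blast
    have "k \<noteq> 0" using s(2) k by auto
    define N where "N = nat \<bar>k * int e\<bar>"
    have N: "0 < N" using \<open>k \<noteq> 0\<close> e by (simp add: N_def)
    have "s [^] e = t [^] (k * int e)" using t by (simp add: k int_pow_pow flip: int_pow_int)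
    then have 1: "t [^] (k * int e) \<in> T" using pow[OF s(1)] by simp
    then have "t [^] (- (k * int e)) \<in> T" using t T by (simp add: int_pow_neg subgroup.m_inv_closed)
    with 1 have tN: "t [^] (int N) \<in> T" by (cases "k * int e \<ge> 0") (simp_all add: N_def)
    have "\<exists>f\<in>(\<lambda>i. t [^] i) ` {..<N}. x \<otimes> inv f \<in> T" if x: "x \<in> S" for x
    proof -
      obtain j :: int where j: "x = t [^] j" using gen subgroup.mem_carrier[OF S x] by blast
      define i where "i = nat (j mod int N)"
      have i: "i < N" "int i = j mod int N" using N by (auto simp: i_def nat_less_iff)
      have "x \<otimes> inv (t [^] i) = t [^] (j - int i)"
        using t j by (simp add: int_pow_diff flip: int_pow_int)
      also have "j - int i = int N * (j div int N)" using i(2) by (simp add: minus_mod_eq_mult_div)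
      also have "t [^] \<dots> = (t [^] int N) [^] (j div int N)" using t by (simp add: int_pow_pow)
      finally have "x \<otimes> inv (t [^] i) \<in> T" using subgroup_int_pow_closed[OF T tN] by simp
      then show ?thesis using i(1) by blast
    qed
    moreover have "(\<lambda>i. t [^] i) ` {..<N} \<subseteq> carrier G" using t by auto
    ultimately show ?thesis unfolding fin_index_def by (intro exI[of _ "(\<lambda>i. t [^] i) ` {..<N}"]) auto
  qed
qed

end

text \<open>Representatives are lifted from the images of \<open>S\<close> and \<open>T\<close>. A
  lifted congruence has an error in \<open>H\<close> that also lies in \<open>S\<close>, and the
  condition \<open>S \<inter> H \<subseteq> T\<close> absorbs it.\<close>

lemma (in normal) bounded_sections_finite_FactGroup:
  assumes "bounded_sections_finite (G Mod H) {\<one>\<^bsub>G Mod H\<^esub>} (carrier (G Mod H))"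
  shows "bounded_sections_finite G H (carrier G)"
proof (rule bounded_sections_finiteI)
  interpret h: group_hom G "G Mod H" "\<lambda>a. H #> a" by (rule group_hom_r_coset)
  fix S T and e :: nat
  assume S: "subgroup S G" and T: "subgroup T G" and TS: "T \<subseteq> S" and SR: "S \<subseteq> carrier G"
    and SH: "S \<inter> H \<subseteq> T" and e: "0 < e"
    and comm: "\<And>x y. x \<in> S \<Longrightarrow> y \<in> S \<Longrightarrow> x \<otimes> y \<otimes> inv x \<otimes> inv y \<in> T"
    and pow: "\<And>x. x \<in> S \<Longrightarrow> x [^] e \<in> T"
  let ?h = "\<lambda>a. H #> a"
  have S': "subgroup (?h ` S) (G Mod H)" and T': "subgroup (?h ` T) (G Mod H)"
    using h.subgroup_img_is_subgroup S T by auto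
  have "fin_index (G Mod H) (?h ` S) (?h ` T)"
  proof (rule bounded_sections_finiteD[OF assms S' T' _ _ _ e])
    show "?h ` T \<subseteq> ?h ` S" using TS by blast
    show "?h ` S \<subseteq> carrier (G Mod H)" using subgroup.subset[OF S'] .
    show "?h ` S \<inter> {\<one>\<^bsub>G Mod H\<^esub>} \<subseteq> ?h ` T" using subgroup.one_closed[OF T'] by blast
    show "x \<otimes>\<^bsub>G Mod H\<^esub> y \<otimes>\<^bsub>G Mod H\<^esub> inv\<^bsub>G Mod H\<^esub> x \<otimes>\<^bsub>G Mod H\<^esub> inv\<^bsub>G Mod H\<^esub> y \<in> ?h ` T"
      if xy: "x \<in> ?h ` S" "y \<in> ?h ` S" for x y
    proof -
      obtain a b where ab: "a \<in> S" "b \<in> S" "x = ?h a" "y = ?h b" using xy by blast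
      then have "a \<in> carrier G" "b \<in> carrier G" using SR by auto
      then have "x \<otimes>\<^bsub>G Mod H\<^esub> y \<otimes>\<^bsub>G Mod H\<^esub> inv\<^bsub>G Mod H\<^esub> x \<otimes>\<^bsub>G Mod H\<^esub> inv\<^bsub>G Mod H\<^esub> y
          = ?h (a \<otimes> b \<otimes> inv a \<otimes> inv b)"
        unfolding ab(3,4) by (simp only: h.hom_mult h.hom_inv m_closed inv_closed)
      then show ?thesis using comm[OF ab(1,2)] by blast
    qed
    show "x [^]\<^bsub>G Mod H\<^esub> e \<in> ?h ` T" if x: "x \<in> ?h ` S" for x
    proof -
      obtain a where a: "a \<in> S" "x = ?h a" using x by blast
      then have "x [^]\<^bsub>G Mod H\<^esub> e = ?h (a [^] e)" using SR by (auto simp: FactGroup_pow)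
      then show ?thesis using pow[OF a(1)] by blast
    qed
  qed
  then obtain F where F: "finite F" "F \<subseteq> ?h ` S"
    "\<And>s. s \<in> ?h ` S \<Longrightarrow> \<exists>f\<in>F. s \<otimes>\<^bsub>G Mod H\<^esub> inv\<^bsub>G Mod H\<^esub> f \<in> ?h ` T"
    using h.H.fin_index_representatives[OF _ T' subgroup.subset[OF S']] by metis
  obtain E where E: "E \<subseteq> S" "finite E" "F = ?h ` E" using finite_subset_image[OF F(1,2)] by blast
  have "\<exists>f\<in>E. s \<otimes> inv f \<in> T" if s: "s \<in> S" for s
  proof -
    obtain f t where f: "f \<in> E" "t \<in> T" "?h s \<otimes>\<^bsub>G Mod H\<^esub> inv\<^bsub>G Mod H\<^esub> (?h f) = ?h t"
      using F(3)[of "?h s"] s E(3) by auto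
    have c: "s \<in> carrier G" "f \<in> carrier G" "t \<in> carrier G" using s f E(1) SR TS by auto
    have "?h (s \<otimes> inv f) = ?h t" using f(3) c by (simp only: h.hom_mult h.hom_inv inv_closed)
    then have "(s \<otimes> inv f) \<otimes> inv t \<in> H" using r_coset_eq_iff[of "s \<otimes> inv f" t] c by simp
    moreover have "(s \<otimes> inv f) \<otimes> inv t \<in> S"
      using s f(1,2) E(1) TS subgroup_mult_inv_closed[OF S] by blast
    ultimately have "(s \<otimes> inv f) \<otimes> inv t \<in> T" using SH by blast
    then have "((s \<otimes> inv f) \<otimes> inv t) \<otimes> t \<in> T" using subgroup.m_closed[OF T _ f(2)] by blast
    then show ?thesis using c f(1) by (auto simp: m_assoc)
  qed
  then show "fin_index G S T" using E SR unfolding fin_index_def by (intro exI[of _ E]) auto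
qed

lemma (in group) bounded_sections_finite_factor:
  assumes R: "subgroup R G" and N: "N \<lhd> G\<lparr>carrier := R\<rparr>"
    and "bounded_sections_finite (G\<lparr>carrier := R\<rparr> Mod N) {\<one>\<^bsub>G\<lparr>carrier := R\<rparr> Mod N\<^esub>} (carrier (G\<lparr>carrier := R\<rparr> Mod N))"
  shows "bounded_sections_finite G N R"
  using bounded_sections_finite_restrict[OF R] normal.bounded_sections_finite_FactGroup[OF N assms(3)]
  by simp

lemma (in group) bounded_sections_finite_cyclic_factor:
  assumes R: "subgroup R G" and N: "subgroup N G" "N \<subseteq> R" "normalizes G R N"
    and t: "t \<in> R" "\<And>x. x \<in> R \<Longrightarrow> \<exists>k::int. x \<otimes> inv (t [^] k) \<in> N"
  shows "bounded_sections_finite G N R"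
proof -
  have nor: "N \<lhd> G\<lparr>carrier := R\<rparr>" using normal_restrict_iff[OF R] N by blast
  interpret N: normal N "G\<lparr>carrier := R\<rparr>" by (rule nor)
  interpret F: group "G\<lparr>carrier := R\<rparr> Mod N" by (rule N.factorgroup_is_group)
  have "\<exists>k::int. C = (N #> t) [^]\<^bsub>G\<lparr>carrier := R\<rparr> Mod N\<^esub> k" if C: "C \<in> carrier (G\<lparr>carrier := R\<rparr> Mod N)" for C
  proof -
    obtain x where x: "x \<in> R" "C = N #> x" using C by (auto simp: carrier_FactGroup)
    obtain k :: int where k: "x \<otimes> inv (t [^] k) \<in> N" using t(2)[OF x(1)] by blast
    have tk: "t [^] k \<in> R" using subgroup_int_pow_closed[OF R t(1)] .
    have "N #> x = N #> (t [^] k)"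
      using N.r_coset_eq_iff[of x "t [^] k"] x(1) tk k R by simp
    then have "C = (N #> t) [^]\<^bsub>G\<lparr>carrier := R\<rparr> Mod N\<^esub> k"
      using N.FactGroup_int_pow[of t k] t(1) x(2) by (simp flip: int_pow_consistent[OF R t(1)])
    then show ?thesis by blast
  qed
  moreover have "N #> t \<in> carrier (G\<lparr>carrier := R\<rparr> Mod N)" using t(1) by (auto simp: carrier_FactGroup)
  ultimately show ?thesis
    using bounded_sections_finite_factor[OF R nor F.bounded_sections_finite_cyclic] by blast
qed

section \<open>Abelian groups of finite rank\<close>

context comm_group
begin

lemma finprod_in_subgroup:
  assumes "subgroup H G" "finite T" "\<And>x. x \<in> T \<Longrightarrow> f x \<in> H"
  shows "finprod G f T \<in> H"
  using assms(2,3)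
proof (induction T rule: finite_induct)
  case empty
  then show ?case using assms(1) by (simp add: subgroup.one_closed)
next
  case (insert x T)
  have "f \<in> T \<rightarrow> carrier G" "f x \<in> carrier G"
    using insert.prems subgroup.mem_carrier[OF assms(1)] by auto
  then show ?case
    using insert subgroup.m_closed[OF assms(1)] by (simp add: finprod_insert)
qed

lemma finite_generate_torsion:
  assumes "finite U" "U \<subseteq> carrier G" "\<And>u. u \<in> U \<Longrightarrow> \<exists>n::nat. n \<noteq> 0 \<and> u [^] n = \<one>"
  shows "finite (generate G U)"
  using assms
proof (induction U rule: finite_induct)
  case empty
  then show ?case by (simp add: generate_empty)
next
  case (insert u U)
  have u: "u \<in> carrier G" and U: "U \<subseteq> carrier G" using insert.prems by auto
  have fu: "finite (generate G {u})"
    using finite_cyclic_subgroup[OF u] insert.prems(2) u by (simp add: carrier_subgroup_generated)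
  have su: "subgroup (generate G {u}) G" "subgroup (generate G U) G"
    using generate_is_subgroup u U by auto
  have "generate G (insert u U) \<subseteq> generate G {u} <#> generate G U"
  proof (rule generate_subgroup_incl)
    show "subgroup (generate G {u} <#> generate G U) G" using mult_subgroups[OF su] .
    show "insert u U \<subseteq> generate G {u} <#> generate G U"
      using set_mult_supset[OF su] by (auto intro: generate.incl)
  qed
  moreover have "finite (generate G U)" using insert.IH[OF U] insert.prems(2) by blast
  then have "finite (generate G {u} <#> generate G U)" using fu by (simp add: set_mult_def)
  ultimately show ?case by (rule finite_subset)
qed

text \<open>A maximal independent set \<open>S\<close> generates all elements killed by
  \<open>p\<close>: one outside the generated subgroup could be added to \<open>S\<close> without
  losing independence. The generated subgroup is finite, having finitely many torsion
  generators.\<close>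

lemma finite_p_torsion:
  assumes "finite_p_rank G p" and p: "Factorial_Ring.prime p"
  shows "finite {x \<in> carrier G. x [^] p = \<one>}"
proof -
  obtain S where S: "finite S" "Zp_independent G p S"
    and max: "\<And>S'. Zp_independent G p S' \<Longrightarrow> S \<subseteq> S' \<Longrightarrow> S' = S"
    using assms(1) unfolding finite_p_rank_def by blast
  have Sord: "x \<in> carrier G" "ord x = p" if "x \<in> S" for x
    using S(2) that unfolding Zp_independent_def by auto
  have Sc: "S \<subseteq> carrier G" using Sord by blast
  have gen: "subgroup (generate G S) G" using generate_is_subgroup[OF Sc] .
  have p0: "p \<noteq> 0" using p by auto
  have "x \<in> generate G S" if x: "x \<in> carrier G" "x [^] p = \<one>" for x
  proof (rule ccontr)
    assume out: "x \<notin> generate G S"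
    have "x \<noteq> \<one>" using out subgroup.one_closed[OF gen] by blast
    then have "ord x \<noteq> 1" using x(1) ord_eq_1 by blast
    then have ordx: "ord x = p" using x pow_eq_id p by (metis prime_nat_iff)
    have "Zp_independent G p (insert x S)"
      unfolding Zp_independent_def
    proof (intro conjI allI impI)
      show "insert x S \<subseteq> {x \<in> carrier G. ord x = p}" using x(1) ordx Sord by blast
      fix T and c :: "'a \<Rightarrow> int"
      assume Tc: "finite T \<and> T \<subseteq> insert x S \<and> (\<Otimes>y\<in>T. y [^] c y) = \<one>"
      have ind: "\<forall>y\<in>U. int p dvd c y" if "finite U" "U \<subseteq> S" "(\<Otimes>y\<in>U. y [^] c y) = \<one>" for U
        using S(2) that unfolding Zp_independent_def by blast
      show "\<forall>y\<in>T. int p dvd c y"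
      proof (cases "x \<in> T")
        case False
        then show ?thesis using Tc by (intro ind) auto
      next
        case True
        define U where "U = T - {x}"
        have U: "finite U" "U \<subseteq> S" "x \<notin> U" "T = insert x U" using Tc True by (auto simp: U_def)
        have Ucar: "(\<lambda>y. y [^] c y) \<in> U \<rightarrow> carrier G" using U(2) Sc by auto
        have prod: "x [^] c x \<otimes> (\<Otimes>y\<in>U. y [^] c y) = \<one>"
          using Tc U x(1) Ucar by simp
        have "(\<Otimes>y\<in>U. y [^] c y) \<in> generate G S"
          using finprod_in_subgroup[OF gen U(1)] U(2) subgroup_int_pow_closed[OF gen] generate.incl
          by (metis subsetD)
        then have "inv (\<Otimes>y\<in>U. y [^] c y) \<in> generate G S" using subgroup.m_inv_closed[OF gen] by blast
        moreover have "x [^] c x = inv (\<Otimes>y\<in>U. y [^] c y)"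
          using prod x(1) finprod_closed[OF Ucar] by (metis inv_equality int_pow_closed)
        ultimately have xin: "x [^] c x \<in> generate G S" by simp
        have px: "int p dvd c x"
        proof (rule ccontr)
          assume "\<not> int p dvd c x"
          then have "coprime (int p) (c x)" using p by (simp add: prime_imp_coprime)
          then obtain a b where ab: "a * int p + b * c x = 1"
            using bezout_int[of "int p" "c x"] by auto
          \<comment> \<open>Since \<open>x^p = 1\<close>, Bezout makes \<open>x\<close> a power of
            \<open>x^(c x)\<close>, which already lies in the generated subgroup.\<close>
          have "x = x [^] (a * int p + b * c x)" using x(1) ab by simp
          also have "\<dots> = x [^] (int p * a) \<otimes> x [^] (c x * b)" using x(1) by (simp add: int_pow_mult ac_simps)
          also have "\<dots> = (x [^] c x) [^] b"
            using x by (simp add: int_pow_int flip: int_pow_pow)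
          finally show False using out subgroup_int_pow_closed[OF gen xin] by metis
        qed
        then have "x [^] c x = \<one>" using int_pow_eq_id[OF x(1)] ordx by simp
        then have "(\<Otimes>y\<in>U. y [^] c y) = \<one>" using prod finprod_closed[OF Ucar] by simp
        then show ?thesis using ind[OF U(1,2)] px U(4) by blast
      qed
    qed
    then have "x \<in> S" using max[of "insert x S"] by blast
    then show False using out generate.incl by metis
  qed
  then have "{x \<in> carrier G. x [^] p = \<one>} \<subseteq> generate G S" by blast
  moreover have "finite (generate G S)"
    using finite_generate_torsion[OF S(1) Sc] Sord p0 by (metis pow_ord_eq_1)
  ultimately show ?thesis by (rule finite_subset)
qed

text \<open>In a finite abelian group \<open>W\<close>, the index of \<open>W\<^sup>p\<close> equals the order of the kernel of the
  \<open>p\<close>-th power map. Applied to the finite subgroups generated by elements in distinct cosets of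
  \<open>T\<close>, this bounds the number of these cosets.\<close>

lemma fin_index_prime_exponent:
  assumes per: "periodic_group G" and fin: "finite {x \<in> carrier G. x [^] p = \<one>}"
    and S: "subgroup S G" and T: "subgroup T G" and pow: "\<And>x. x \<in> S \<Longrightarrow> x [^] (p::nat) \<in> T"
  shows "fin_index G S T"
proof (rule ccontr)
  assume inf: "\<not> fin_index G S T"
  have Sc: "S \<subseteq> carrier G" using subgroup.subset[OF S] .
  define N where "N = card {x \<in> carrier G. x [^] p = \<one>}"
  have "\<exists>U. finite U \<and> U \<subseteq> S \<and> card U = n \<and> (\<forall>u\<in>U. \<forall>v\<in>U. u \<otimes> inv v \<in> T \<longrightarrow> u = v)" for n
  proof (induction n)
    case 0
    then show ?case by (intro exI[of _ "{}"]) auto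
  next
    case (Suc n)
    then obtain U where U: "finite U" "U \<subseteq> S" "card U = n" "\<forall>u\<in>U. \<forall>v\<in>U. u \<otimes> inv v \<in> T \<longrightarrow> u = v"
      by (elim exE conjE)
    have "U \<subseteq> carrier G" using U(2) Sc by (rule subset_trans)
    then have "\<not> (\<forall>s\<in>S. \<exists>f\<in>U. s \<otimes> inv f \<in> T)" using inf U(1) unfolding fin_index_def by simp
    then obtain s where s: "s \<in> S" "\<And>u. u \<in> U \<Longrightarrow> s \<otimes> inv u \<notin> T" by blast
    have "u \<otimes> inv s \<notin> T" if u: "u \<in> U" for u
    proof
      assume "u \<otimes> inv s \<in> T"
      then have "inv (u \<otimes> inv s) \<in> T" using subgroup.m_inv_closed[OF T] by blast
      moreover have "s \<in> carrier G" "u \<in> carrier G" using u s U Sc by auto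
      ultimately show False using s(2)[OF u] by (simp add: inv_mult_group)
    qed
    moreover have "s \<notin> U"
    proof
      assume "s \<in> U"
      then have "s \<otimes> inv s \<notin> T" using s(2) by blast
      then show False using s(1) Sc subgroup.one_closed[OF T] by auto
    qed
    ultimately show ?case using U s by (intro exI[of _ "insert s U"]) auto
  qed
  \<comment> \<open>One element more than the kernel of the power map has.\<close>
  from this[of "Suc N"] obtain U where U: "finite U" "U \<subseteq> S" "card U = Suc N"
    "\<forall>u\<in>U. \<forall>v\<in>U. u \<otimes> inv v \<in> T \<longrightarrow> u = v" by (elim exE conjE)
  have Uc: "U \<subseteq> carrier G" using U(2) Sc by blast
  define W where "W = generate G U"
  have W: "subgroup W G" "W \<subseteq> S" "U \<subseteq> W"
    using generate_is_subgroup[OF Uc] generate_subgroup_incl[OF U(2) S] generate.incl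
    unfolding W_def by auto
  have Wc: "W \<subseteq> carrier G" using W(1) subgroup.subset by blast
  have "\<exists>n::nat. n \<noteq> 0 \<and> u [^] n = \<one>" if "u \<in> U" for u
    using per that Uc unfolding periodic_group_def by (metis subsetD not_gr_zero)
  then have finW: "finite W" unfolding W_def using finite_generate_torsion[OF U(1) Uc] by blast
  define V where "V = (\<lambda>x. x [^] p) ` W"
  have VT: "V \<subseteq> T" using pow W(2) unfolding V_def by blast
  have VW: "V \<subseteq> W" using subgroup_nat_pow_closed[OF W(1)] unfolding V_def by blast
  have finV: "finite V" using finW unfolding V_def by blast
  \<comment> \<open>The products \<open>u v\<close> are distinct, because \<open>V\<close> lies in
    \<open>T\<close> while different elements of \<open>U\<close> lie in different cosets of
    \<open>T\<close>.\<close>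
  have "card (U \<times> V) \<le> card W"
  proof (rule card_inj_on_le[of "\<lambda>(u, v). u \<otimes> v"])
    show "inj_on (\<lambda>(u, v). u \<otimes> v) (U \<times> V)"
    proof (rule inj_onI, clarsimp)
      fix u v u' v' assume a: "u \<in> U" "v \<in> V" "u' \<in> U" "v' \<in> V" "u \<otimes> v = u' \<otimes> v'"
      have c: "u \<in> carrier G" "v \<in> carrier G" "u' \<in> carrier G" "v' \<in> carrier G"
        using a Uc VW Wc by auto
      have "u \<otimes> inv u' = v' \<otimes> inv v"
      proof -
        have "u = u' \<otimes> v' \<otimes> inv v" using a(5) c by (metis inv_solve_right m_closed)
        also have "\<dots> = v' \<otimes> inv v \<otimes> u'" using c by (simp add: m_ac)
        finally show ?thesis using c by (simp add: m_assoc)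
      qed
      then have "u \<otimes> inv u' \<in> T" using subgroup_mult_inv_closed[OF T] a VT by auto
      then have "u = u'" using U(4) a by blast
      then show "u = u' \<and> v = v'" using a(5) c by simp
    qed
    show "(\<lambda>(u, v). u \<otimes> v) ` (U \<times> V) \<subseteq> W"
      using W(3) VW subgroup.m_closed[OF W(1)] by auto
  qed (rule finW)
  moreover have "card W \<le> N * card V"
  proof -
    \<comment> \<open>Division by one fixed preimage \<open>w\<close> embeds the fibre over
      \<open>y\<close> into the kernel.\<close>
    have fib: "card {x \<in> W. x [^] p = y} \<le> N" if "y \<in> V" for y
    proof -
      obtain w where w: "w \<in> W" "w [^] p = y" using \<open>y \<in> V\<close> unfolding V_def by blast
      show ?thesis unfolding N_def
      proof (rule card_inj_on_le[of "\<lambda>x. x \<otimes> inv w"])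
        show "inj_on (\<lambda>x. x \<otimes> inv w) {x \<in> W. x [^] p = y}"
          using Wc w(1) by (auto simp: inj_on_def subset_iff)
        show "(\<lambda>x. x \<otimes> inv w) ` {x \<in> W. x [^] p = y} \<subseteq> {x \<in> carrier G. x [^] p = \<one>}"
          using Wc w by (auto simp: subset_iff nat_pow_distrib nat_pow_inv)
      qed (rule fin)
    qed
    have "W = (\<Union>y\<in>V. {x \<in> W. x [^] p = y})" unfolding V_def by auto
    then have "card W = card (\<Union>y\<in>V. {x \<in> W. x [^] p = y})" by simp
    also have "\<dots> \<le> (\<Sum>y\<in>V. card {x \<in> W. x [^] p = y})" by (rule card_UN_le[OF finV])
    also have "\<dots> \<le> (\<Sum>y\<in>V. N)" by (rule sum_mono) (rule fib)
    finally show ?thesis by (simp add: mult.commute)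
  qed
  ultimately have "Suc N * card V \<le> N * card V" using U(3) by (simp add: card_cartesian_product)
  moreover have "\<one> [^] p \<in> V" unfolding V_def using subgroup.one_closed[OF W(1)] by blast
  then have "0 < card V" using finV card_gt_0_iff by blast
  ultimately show False by simp
qed

text \<open>Induction on the exponent peels off one prime. With \<open>e = p * k\<close>, the group
  \<open>R\<close> of elements of \<open>S\<close> whose \<open>k\<close>-th power lies in
  \<open>T\<close> contains the \<open>p\<close>-th powers of \<open>S\<close>, and its own
  \<open>k\<close>-th powers lie in \<open>T\<close>.\<close>

lemma bounded_sections_finite_torsion:
  assumes per: "periodic_group G"
    and fin: "\<And>p. Factorial_Ring.prime p \<Longrightarrow> finite {x \<in> carrier G. x [^] (p::nat) = \<one>}"
  shows "bounded_sections_finite G {\<one>} (carrier G)"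
proof (rule bounded_sections_finiteI)
  fix S T and e :: nat
  assume "subgroup S G" "subgroup T G" "T \<subseteq> S" "0 < e" "\<And>x. x \<in> S \<Longrightarrow> x [^] e \<in> T"
  then show "fin_index G S T"
  proof (induction e arbitrary: S T rule: less_induct)
    case (less e)
    note S = less.prems(1) and T = less.prems(2) and TS = less.prems(3) and pow = less.prems(5)
    show ?case
    proof (cases "e = 1")
      case True
      then have "S \<subseteq> T" using pow subgroup.mem_carrier[OF S] by fastforce
      then show ?thesis using fin_index_subset subgroup.subset[OF S] by blast
    next
      case False
      then obtain p where p: "Factorial_Ring.prime p" "p dvd e" using prime_factor_nat by blast
      then obtain k where k: "e = p * k" by (elim dvdE)
      have kpos: "0 < k" "k < e"
        using k less.prems(4) prime_gt_1_nat[OF p(1)] by (auto intro: Nat.gr0I)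
      define R where "R = {x \<in> S. x [^] k \<in> T}"
      have R: "subgroup R G"
      proof (rule subgroupI)
        show "R \<subseteq> carrier G" using subgroup.subset[OF S] by (auto simp: R_def)
        have "\<one> \<in> R" using subgroup.one_closed[OF S] subgroup.one_closed[OF T] by (simp add: R_def)
        then show "R \<noteq> {}" by blast
        fix x assume x: "x \<in> R"
        then have xS: "x \<in> S" "x \<in> carrier G" "x [^] k \<in> T" using subgroup.mem_carrier[OF S] by (auto simp: R_def)
        then show "inv x \<in> R"
          using subgroup.m_inv_closed[OF S xS(1)] subgroup.m_inv_closed[OF T xS(3)]
          by (simp add: R_def nat_pow_inv)
        fix y assume y: "y \<in> R"
        then have yS: "y \<in> S" "y \<in> carrier G" "y [^] k \<in> T" using subgroup.mem_carrier[OF S] by (auto simp: R_def)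
        show "x \<otimes> y \<in> R"
          using subgroup.m_closed[OF S xS(1) yS(1)] subgroup.m_closed[OF T xS(3) yS(3)] xS(2) yS(2)
          by (simp add: R_def nat_pow_distrib)
      qed
      have "x [^] p \<in> R" if x: "x \<in> S" for x
        using pow[OF x] subgroup_nat_pow_closed[OF S x] subgroup.mem_carrier[OF S x]
        by (simp add: R_def k nat_pow_pow)
      then have "fin_index G S R"
        using fin_index_prime_exponent[OF per fin[OF p(1)] S R] by blast
      moreover have "fin_index G R T"
      proof (rule less.IH[OF kpos(2) R T _ kpos(1)])
        show "T \<subseteq> R" using TS subgroup_nat_pow_closed[OF T] by (auto simp: R_def)
        show "x [^] k \<in> T" if "x \<in> R" for x using that by (simp add: R_def)
      qed
      ultimately show ?thesis
        using fin_index_trans[OF _ _ T] subgroup.subset[OF S] subgroup.subset[OF R] by blast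
    qed
  qed
qed

lemma normalizes_all: "L \<subseteq> carrier G \<Longrightarrow> C \<subseteq> carrier G \<Longrightarrow> normalizes G L C"
  unfolding normalizes_def
proof (intro ballI)
  fix l c assume "L \<subseteq> carrier G" "C \<subseteq> carrier G" "l \<in> L" "c \<in> C"
  then have "l \<in> carrier G" "c \<in> carrier G" by auto
  then have "l \<otimes> c \<otimes> inv l = c" by (simp add: m_comm[of l c] m_assoc)
  then show "l \<otimes> c \<otimes> inv l \<in> C" using \<open>c \<in> C\<close> by simp
qed

text \<open>\<open>F\<close> is generated by one lift \<open>g\<close> for each infinite cyclic
  step, while periodic steps contribute nothing. If \<open>x\<close> is congruent to
  \<open>g^k\<close> modulo the previous term, a power of \<open>x g^(-k)\<close> lies in the old
  \<open>F\<close>, and commutativity puts the same power of \<open>x\<close> into the enlarged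
  one.\<close>

lemma bounded_sections_finite_periodic_mod:
  assumes "hirsch_chain G {\<one>} r Q"
  shows "\<exists>F. subgroup F G \<and> F \<subseteq> Q \<and> bounded_sections_finite G {\<one>} F \<and> periodic_mod G F Q"
  using assms
proof (induction rule: hirsch_chain.induct)
  case hc_refl
  have "periodic_mod G {\<one>} {\<one>}" unfolding periodic_mod_def by (auto intro: exI[of _ 1])
  then show ?case using hc_refl bounded_sections_finite_refl by blast
next
  case (hc_periodic r Q R)
  then obtain F where F: "subgroup F G" "F \<subseteq> Q" "bounded_sections_finite G {\<one>} F" "periodic_mod G F Q"
    by blast
  have "periodic_mod G F R"
    unfolding periodic_mod_def
  proof
    fix x assume x: "x \<in> R"
    obtain m :: nat where m: "0 < m" "x [^] m \<in> Q" using hc_periodic(5) x unfolding periodic_mod_def by blast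
    obtain n :: nat where n: "0 < n" "(x [^] m) [^] n \<in> F" using F(4) m(2) unfolding periodic_mod_def by blast
    have "x [^] (m * n) \<in> F" using n(2) subgroup.mem_carrier[OF hc_periodic(2) x] by (simp add: nat_pow_pow)
    then show "\<exists>n::nat. 0 < n \<and> x [^] n \<in> F" using m(1) n(1) by (intro exI[of _ "m * n"]) simp
  qed
  then show ?case using F hc_periodic(3) by blast
next
  case (hc_cyclic r Q R)
  then obtain F where F: "subgroup F G" "F \<subseteq> Q" "bounded_sections_finite G {\<one>} F" "periodic_mod G F Q"
    by blast
  obtain g where g: "g \<in> R" "\<And>x. x \<in> R \<Longrightarrow> \<exists>k::int. x \<otimes> inv (g [^] k) \<in> Q"
    using hc_cyclic(5) unfolding infinite_cyclic_mod_def by blast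
  have gc: "g \<in> carrier G" using subgroup.mem_carrier[OF hc_cyclic(2) g(1)] .
  have gg: "subgroup (generate G {g}) G" using generate_is_subgroup gc by blast
  define E where "E = F <#> generate G {g}"
  have E: "subgroup E G" unfolding E_def using mult_subgroups[OF F(1) gg] .
  have sub: "F \<subseteq> E" "generate G {g} \<subseteq> E" using set_mult_supset[OF F(1) gg] by (auto simp: E_def)
  have gE: "g \<in> E" using sub(2) generate.incl[of g "{g}"] by blast
  have "generate G {g} \<subseteq> R" using generate_subgroup_incl[OF _ hc_cyclic(2)] g(1) by blast
  then have ER: "E \<subseteq> R" using set_mult_least[OF hc_cyclic(2)] F(2) hc_cyclic(3) unfolding E_def by blast
  have "\<exists>k::int. x \<otimes> inv (g [^] k) \<in> F" if x: "x \<in> E" for x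
  proof -
    obtain f h where fh: "f \<in> F" "h \<in> generate G {g}" "x = f \<otimes> h" using x by (auto simp: E_def set_mult_def)
    obtain k :: int where "h = g [^] k" using fh(2) generate_pow[OF gc] by blast
    then have "x \<otimes> inv (g [^] k) = f" using fh gc subgroup.mem_carrier[OF F(1)] by (simp add: m_assoc)
    then show ?thesis using fh(1) by blast
  qed
  moreover have nEF: "normalizes G E F" using normalizes_all subgroup.subset[OF E] subgroup.subset[OF F(1)] by blast
  ultimately have "bounded_sections_finite G F E"
    using bounded_sections_finite_cyclic_factor[OF E F(1) sub(1) _ gE] by blast
  then have "bounded_sections_finite G {\<one>} E"
    using bounded_sections_finite_trans[OF F(3) _ F(1) nEF] subgroup.one_closed[OF F(1)] by blast
  moreover have "periodic_mod G E R"
    unfolding periodic_mod_def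
  proof
    fix x assume x: "x \<in> R"
    obtain k :: int where k: "x \<otimes> inv (g [^] k) \<in> Q" using g(2)[OF x] by blast
    obtain n :: nat where n: "0 < n" "(x \<otimes> inv (g [^] k)) [^] n \<in> F" using F(4) k unfolding periodic_mod_def by blast
    have xc: "x \<in> carrier G" using subgroup.mem_carrier[OF hc_cyclic(2) x] .
    have "(x \<otimes> inv (g [^] k)) [^] n \<otimes> (g [^] k) [^] n \<in> E"
      using n(2) sub(1) subgroup.m_closed[OF E] subgroup_nat_pow_closed[OF E subgroup_int_pow_closed[OF E gE]] by blast
    then have "x [^] n \<in> E" using xc gc by (simp add: nat_pow_distrib m_assoc nat_pow_inv)
    then show "\<exists>n::nat. 0 < n \<and> x [^] n \<in> E" using n(1) by blast
  qed
  ultimately show ?case using E ER by blast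
qed

lemma commutator_eq_one:
  "x \<in> carrier G \<Longrightarrow> y \<in> carrier G \<Longrightarrow> x \<otimes> y \<otimes> inv x \<otimes> inv y = \<one>"
  by (simp add: m_comm[of x y] m_assoc)

text \<open>New \<open>p\<close>-torsion modulo \<open>F\<close> comes from elements
  \<open>x\<close> with \<open>x^p\<close> in \<open>F\<close>. These powers fall into finitely many
  classes modulo the subgroup \<open>Fp\<close> of \<open>p\<close>-th powers of \<open>F\<close>,
  since \<open>F/Fp\<close> is finite. Two elements in the same class differ by an element of
  \<open>F\<close> and an element killed by \<open>p\<close>.\<close>

lemma finite_p_torsion_Mod:
  assumes F: "subgroup F G" and b: "bounded_sections_finite G {\<one>} F"
    and fin: "finite {x \<in> carrier G. x [^] p = \<one>}" and p: "0 < (p::nat)"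
  shows "finite {C \<in> carrier (G Mod F). C [^]\<^bsub>G Mod F\<^esub> p = F}"
proof -
  interpret F: normal F G using subgroup_imp_normal[OF F] .
  have Fc: "F \<subseteq> carrier G" using F.subset .
  define P where "P = {x \<in> carrier G. x [^] p \<in> F}"
  define Fp where "Fp = (\<lambda>x. x [^] p) ` F"
  have Fp: "subgroup Fp G"
  proof (rule subgroupI)
    show "Fp \<subseteq> carrier G" using Fc by (auto simp: Fp_def)
    show "Fp \<noteq> {}" unfolding Fp_def using subgroup.one_closed[OF F] by blast
    show "inv x \<in> Fp" if "x \<in> Fp" for x
    proof -
      obtain f where f: "f \<in> F" "x = f [^] p" using \<open>x \<in> Fp\<close> by (auto simp: Fp_def)
      then have "inv x = (inv f) [^] p" by (simp add: nat_pow_inv)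
      then show ?thesis unfolding Fp_def using F.m_inv_closed[OF f(1)] by blast
    qed
    show "x \<otimes> y \<in> Fp" if xy: "x \<in> Fp" "y \<in> Fp" for x y
    proof -
      obtain f g where f: "f \<in> F" "x = f [^] p" "g \<in> F" "y = g [^] p" using xy by (auto simp: Fp_def)
      then have "x \<otimes> y = (f \<otimes> g) [^] p" by (simp add: nat_pow_distrib)
      then show ?thesis unfolding Fp_def using F.m_closed[OF f(1,3)] by blast
    qed
  qed
  have "fin_index G F Fp"
  proof (rule bounded_sections_finiteD[OF b F Fp _ _ _ p])
    show "Fp \<subseteq> F" using subgroup_nat_pow_closed[OF F] by (auto simp: Fp_def)
    show "F \<inter> {\<one>} \<subseteq> Fp" using subgroup.one_closed[OF Fp] by blast
    show "x \<otimes> y \<otimes> inv x \<otimes> inv y \<in> Fp" if "x \<in> F" "y \<in> F" for x y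
    proof -
      have "x \<otimes> y \<otimes> inv x \<otimes> inv y = \<one>" using that by (intro commutator_eq_one) auto
      then show ?thesis using subgroup.one_closed[OF Fp] by simp
    qed
    show "x [^] p \<in> Fp" if "x \<in> F" for x using that by (simp add: Fp_def)
  qed simp
  then have fi: "fin_index G ((\<lambda>x. x [^] p) ` P) Fp"
    by (rule fin_index_mono) (auto simp: P_def)
  have "(\<lambda>x. x [^] p) ` P \<subseteq> carrier G" by (auto simp: P_def)
  then obtain Y where Y: "finite Y" "Y \<subseteq> (\<lambda>x. x [^] p) ` P"
    "\<And>s. s \<in> (\<lambda>x. x [^] p) ` P \<Longrightarrow> \<exists>f\<in>Y. s \<otimes> inv f \<in> Fp"
    using fin_index_representatives[OF fi Fp] by blast
  obtain Z where Z: "Z \<subseteq> P" "finite Z" "Y = (\<lambda>x. x [^] p) ` Z" using finite_subset_image[OF Y(1,2)] by blast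
  have "{C \<in> carrier (G Mod F). C [^]\<^bsub>G Mod F\<^esub> p = F} \<subseteq> (\<lambda>(a, z). F #> (a \<otimes> z)) ` ({x \<in> carrier G. x [^] p = \<one>} \<times> Z)"
  proof
    fix C assume "C \<in> {C \<in> carrier (G Mod F). C [^]\<^bsub>G Mod F\<^esub> p = F}"
    then obtain x where x: "x \<in> carrier G" "C = F #> x" "C [^]\<^bsub>G Mod F\<^esub> p = F" by (auto simp: carrier_FactGroup)
    then have "x [^] p \<in> F" using F.r_coset_eq_self_iff[of "x [^] p"] by (simp add: F.FactGroup_pow)
    then have "x \<in> P" using x(1) by (simp add: P_def)
    then obtain z where z: "z \<in> Z" "x [^] p \<otimes> inv (z [^] p) \<in> Fp" using Y(3)[of "x [^] p"] Z(3) by auto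
    then obtain f where f: "f \<in> F" "x [^] p \<otimes> inv (z [^] p) = f [^] p" by (auto simp: Fp_def)
    have c: "z \<in> carrier G" "f \<in> carrier G" using z(1) Z(1) f(1) by (auto simp: P_def)
    \<comment> \<open>Here \<open>f\<close> comes from \<open>F\<close> and \<open>z\<close>
      represents the class of \<open>x^p\<close>. Dividing \<open>x\<close> by both leaves an
      element killed by \<open>p\<close>, and \<open>f\<close> vanishes in the quotient by
      \<open>F\<close>.\<close>
    define a where "a = x \<otimes> inv f \<otimes> inv z"
    have a: "a \<in> carrier G" using x(1) c by (simp add: a_def)
    have "a [^] p = x [^] p \<otimes> inv (f [^] p) \<otimes> inv (z [^] p)"
      using x(1) c by (simp add: a_def nat_pow_distrib nat_pow_inv)
    also have "\<dots> = \<one>"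
      using commutator_eq_one[of "x [^] p" "z [^] p"] x(1) c
      by (simp add: f(2)[symmetric] inv_mult_group m_assoc)
    finally have "a [^] p = \<one>" .
    moreover have "x \<otimes> inv (a \<otimes> z) = f"
      using x(1) c m_comm[of f "inv x"] by (simp add: a_def inv_mult_group m_assoc)
    then have "C = F #> (a \<otimes> z)" using F.r_coset_eq_iff[of x "a \<otimes> z"] x(1,2) a c(1) f(1) by simp
    ultimately show "C \<in> (\<lambda>(a, z). F #> (a \<otimes> z)) ` ({x \<in> carrier G. x [^] p = \<one>} \<times> Z)"
      using a z(1) by auto
  qed
  then show ?thesis using fin Z(2) finite_subset by blast
qed

lemma bounded_sections_finite_abelian:
  assumes h: "finite_torsion_free_rank G"
    and p: "\<And>p. Factorial_Ring.prime p \<Longrightarrow> finite_p_rank G p"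
  shows "bounded_sections_finite G {\<one>} (carrier G)"
proof -
  obtain r where "hirsch_chain G {\<one>} r (carrier G)" using hirsch_chain_carrier[OF h] by blast
  then obtain F where F: "subgroup F G" "bounded_sections_finite G {\<one>} F" "periodic_mod G F (carrier G)"
    using bounded_sections_finite_periodic_mod by blast
  interpret F: normal F G using subgroup_imp_normal[OF F(1)] .
  interpret Q: comm_group "G Mod F" using abelian_FactGroup[OF F(1)] .
  have "periodic_group (G Mod F)" using F.periodic_FactGroup_iff F(3) by blast
  moreover have "finite {C \<in> carrier (G Mod F). C [^]\<^bsub>G Mod F\<^esub> q = \<one>\<^bsub>G Mod F\<^esub>}"
    if q: "Factorial_Ring.prime q" for q :: nat
    using finite_p_torsion_Mod[OF F(1,2) finite_p_torsion[OF p[OF q] q]] prime_gt_0_nat[OF q] by simp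
  ultimately have "bounded_sections_finite G F (carrier G)"
    using F.bounded_sections_finite_FactGroup Q.bounded_sections_finite_torsion by blast
  then show ?thesis
    using bounded_sections_finite_trans[OF F(2) _ F(1)] normalizes_all[OF order_refl subgroup.subset[OF F(1)]]
      subgroup.one_closed[OF F(1)] by blast
qed

end

section \<open>Subgroups of full rank\<close>

context group
begin

lemma solvable_FAR_group_bounds:
  assumes "solvable_FAR_group G"
  shows "\<exists>r. hirsch_chain G {\<one>} r (carrier G)" "bounded_sections_finite G {\<one>} (carrier G)"
proof -
  obtain n K where ser: "subnormal_series G n K"
    and fac: "\<And>i. i < n \<Longrightarrow> comm_group (series_factor G K i) \<and>
      finite_torsion_free_rank (series_factor G K i) \<and>
      (\<forall>p::nat. Factorial_Ring.prime p \<longrightarrow> finite_p_rank (series_factor G K i) p)"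
    using assms unfolding solvable_FAR_group_def by blast
  have ser': "subnormal_series (G\<lparr>carrier := carrier G\<rparr>) n K" using ser by simp
  have "(\<exists>r. hirsch_chain G {\<one>} r (K i)) \<and> bounded_sections_finite G {\<one>} (K i)" if "i \<le> n" for i
    using that
  proof (induction i)
    case 0
    have "K 0 = {\<one>}" using ser by (simp add: subnormal_series_def)
    then show ?case
      using hirsch_chain.hc_refl[OF triv_subgroup] bounded_sections_finite_refl by auto
  next
    case (Suc i)
    then obtain r where r: "hirsch_chain G {\<one>} r (K i)" and b: "bounded_sections_finite G {\<one>} (K i)"
      by auto
    have i: "i < n" using Suc.prems by simp
    have sub: "subgroup (K (Suc i)) G" using subnormal_series_subgroup[OF ser' subgroup_self Suc.prems] .
    have nor: "K i \<lhd> G\<lparr>carrier := K (Suc i)\<rparr>" using ser i by (simp add: subnormal_series_def)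
    have rel: "subgroup (K i) G" "normalizes G (K (Suc i)) (K i)"
      using normal_restrict_iff[OF sub] nor by auto
    note F = fac[OF i, unfolded series_factor_def]
    interpret F: comm_group "G\<lparr>carrier := K (Suc i)\<rparr> Mod K i" using F by blast
    obtain s where "hirsch_chain G (K i) s (K (Suc i))"
      using hirsch_chain_factor[OF sub nor] F by blast
    moreover have "bounded_sections_finite G (K i) (K (Suc i))"
      using bounded_sections_finite_factor[OF sub nor] F.bounded_sections_finite_abelian F by blast
    then have "bounded_sections_finite G {\<one>} (K (Suc i))"
      using bounded_sections_finite_trans[OF b _ rel] subgroup.one_closed[OF rel(1)] by blast
    ultimately show ?case using hirsch_chain_trans[OF _ r] by blast
  qed
  moreover have "K n = carrier G" using ser by (simp add: subnormal_series_def)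
  ultimately show "\<exists>r. hirsch_chain G {\<one>} r (carrier G)" "bounded_sections_finite G {\<one>} (carrier G)"
    by (metis order_refl)+
qed

text \<open>\<open>E\<close> is not assumed to be a subgroup; it will be a union of cosets. Closure
  under right multiplication by generators and their inverses is enough if the induction quantifies
  over all left factors in \<open>E\<close>.\<close>

lemma generate_subset_if_closed:
  assumes "S \<subseteq> carrier G" "E \<subseteq> carrier G" "\<one> \<in> E"
    and "\<And>x s. x \<in> E \<Longrightarrow> s \<in> S \<Longrightarrow> x \<otimes> s \<in> E"
    and "\<And>x s. x \<in> E \<Longrightarrow> s \<in> S \<Longrightarrow> x \<otimes> inv s \<in> E"
  shows "generate G S \<subseteq> E"
proof -
  have "\<forall>x\<in>E. x \<otimes> y \<in> E" if "y \<in> generate G S" for y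
    using that
  proof (induction rule: generate.induct)
    case one
    then show ?case using assms(2) by (simp add: subset_iff)
  next
    case (incl s)
    then show ?case using assms(4) by blast
  next
    case (inv s)
    then show ?case using assms(5) by blast
  next
    case (eng u v)
    show ?case
    proof
      fix x assume x: "x \<in> E"
      have "(x \<otimes> u) \<otimes> v \<in> E" using eng.IH x by blast
      moreover have "u \<in> carrier G" "v \<in> carrier G" "x \<in> carrier G"
        using generate_in_carrier[OF assms(1)] eng.hyps x assms(2) by auto
      ultimately show "x \<otimes> (u \<otimes> v) \<in> E" by (simp add: m_assoc)
    qed
  qed
  then have "\<one> \<otimes> y \<in> E" if "y \<in> generate G S" for y using that assms(3) by blast
  then show ?thesis using generate_in_carrier[OF assms(1)] by auto
qed

text \<open>Schreier's argument: the elements \<open>f s r(f s)^(-1)\<close> lie in \<open>M\<close>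
  and allow any generator \<open>s\<close> to be pushed through a representative \<open>f\<close>,
  so \<open>generate G U <#> E\<close> is all of \<open>G\<close>.\<close>

lemma generated_by_finite_of_fin_index:
  assumes gen: "finite S" "S \<subseteq> carrier G" "generate G S = carrier G"
    and M: "subgroup M G" and "fin_index G (carrier G) M"
  shows "\<exists>U. finite U \<and> U \<subseteq> M \<and> generate G U = M"
proof -
  obtain F where F: "finite F" "F \<subseteq> carrier G" "\<And>g. g \<in> carrier G \<Longrightarrow> \<exists>f\<in>F. g \<otimes> inv f \<in> M"
    using assms(5) unfolding fin_index_def by blast
  define S' where "S' = S \<union> (\<lambda>s. inv s) ` S"
  have S': "finite S'" "S' \<subseteq> carrier G" using gen(1,2) by (auto simp: S'_def)
  define E where "E = insert \<one> F"
  have E: "finite E" "E \<subseteq> carrier G" using F(1,2) by (auto simp: E_def)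
  obtain r where r: "\<And>g. g \<in> carrier G \<Longrightarrow> r g \<in> F \<and> g \<otimes> inv (r g) \<in> M" using F(3) by metis
  \<comment> \<open>\<open>E\<close> is not a transversal: besides the identity it may contain other
    elements of \<open>M\<close>. When an element of \<open>M\<close> is written as
    \<open>v f\<close>, the factor \<open>f\<close> can be any of them, so they are added to the
    generators.\<close>
  define U where "U = (\<lambda>(f, s). f \<otimes> s \<otimes> inv (r (f \<otimes> s))) ` (E \<times> S') \<union> (E \<inter> M)"
  have fs: "f \<otimes> s \<in> carrier G" if "f \<in> E" "s \<in> S'" for f s using that E(2) S'(2) by auto
  have U: "finite U" "U \<subseteq> M"
    using E(1) S'(1) r[OF fs] by (auto simp: U_def)
  have Uc: "U \<subseteq> carrier G" using U(2) subgroup.subset[OF M] by blast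
  have gU: "subgroup (generate G U) G" using generate_is_subgroup[OF Uc] .
  have step: "u \<otimes> s \<in> generate G U <#> E" if u: "u \<in> generate G U <#> E" and s: "s \<in> S'" for u s
  proof -
    obtain v f where v: "v \<in> generate G U" "f \<in> E" "u = v \<otimes> f" using u by (auto simp: set_mult_def)
    have c: "v \<in> carrier G" "f \<in> carrier G" "s \<in> carrier G" "r (f \<otimes> s) \<in> carrier G"
      using v s E(2) S'(2) r[OF fs[OF v(2) s]] F(2) subgroup.mem_carrier[OF gU] by auto
    have "f \<otimes> s \<otimes> inv (r (f \<otimes> s)) \<in> U" using v(2) s by (auto simp: U_def)
    then have "v \<otimes> (f \<otimes> s \<otimes> inv (r (f \<otimes> s))) \<in> generate G U"
      using subgroup.m_closed[OF gU v(1)] generate.incl by metis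
    moreover have "r (f \<otimes> s) \<in> E" using r[OF fs[OF v(2) s]] by (simp add: E_def)
    moreover have "u \<otimes> s = v \<otimes> (f \<otimes> s \<otimes> inv (r (f \<otimes> s))) \<otimes> r (f \<otimes> s)"
      using c v(3) by (simp add: m_assoc)
    ultimately show ?thesis unfolding set_mult_def by blast
  qed
  have "generate G S \<subseteq> generate G U <#> E"
  proof (rule generate_subset_if_closed[OF gen(2)])
    show "generate G U <#> E \<subseteq> carrier G"
      using set_mult_closed[OF subgroup.subset[OF gU] E(2)] .
    have "\<one> \<otimes> \<one> \<in> generate G U <#> E"
      using subgroup.one_closed[OF gU] unfolding set_mult_def E_def by blast
    then show "\<one> \<in> generate G U <#> E" by simp
    show "x \<otimes> s \<in> generate G U <#> E" if "x \<in> generate G U <#> E" "s \<in> S" for x s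
      by (rule step[OF that(1)]) (use that(2) in \<open>simp add: S'_def\<close>)
    show "x \<otimes> inv s \<in> generate G U <#> E" if "x \<in> generate G U <#> E" "s \<in> S" for x s
      by (rule step[OF that(1)]) (use that(2) in \<open>simp add: S'_def\<close>)
  qed
  then have all: "carrier G \<subseteq> generate G U <#> E" using gen(3) by simp
  have le: "generate G U \<subseteq> M" using generate_subgroup_incl[OF U(2) M] .
  have "m \<in> generate G U" if m: "m \<in> M" for m
  proof -
    have mc: "m \<in> carrier G" using m subgroup.mem_carrier[OF M] by blast
    then obtain v f where v: "v \<in> generate G U" "f \<in> E" "m = v \<otimes> f" using all by (auto simp: set_mult_def)
    have c: "v \<in> carrier G" "f \<in> carrier G" using v E(2) subgroup.mem_carrier[OF gU] by auto
    have "f = inv v \<otimes> m" using v(3) c by simp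
    then have "f \<in> M" using subgroup.m_closed[OF M subgroup.m_inv_closed[OF M] m] v(1) le by blast
    then have "f \<in> U" using v(2) by (simp add: U_def)
    then show ?thesis using v(1,3) subgroup.m_closed[OF gU] generate.incl by metis
  qed
  then show ?thesis using U le by blast
qed

lemma nat_pow_conj:
  assumes "h \<in> carrier G" "a \<in> carrier G"
  shows "(h \<otimes> a \<otimes> inv h) [^] (n::nat) = h \<otimes> a [^] n \<otimes> inv h"
  by (induction n) (use assms in \<open>simp_all add: m_assoc\<close>)

lemma normalizes_of_commutators:
  assumes A: "subgroup A G" and B: "subgroup B G" "B \<subseteq> A"
    and comm: "\<And>x y. x \<in> A \<Longrightarrow> y \<in> A \<Longrightarrow> x \<otimes> y \<otimes> inv x \<otimes> inv y \<in> B"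
  shows "normalizes G A B"
  unfolding normalizes_def
proof (intro ballI)
  fix x y assume x: "x \<in> A" and y: "y \<in> B"
  have c: "x \<in> carrier G" "y \<in> carrier G"
    using x y subgroup.mem_carrier[OF A] subgroup.mem_carrier[OF B(1)] by auto
  have "(x \<otimes> y \<otimes> inv x \<otimes> inv y) \<otimes> y \<in> B"
    using comm[OF x] y B(2) subgroup.m_closed[OF B(1)] by blast
  then show "x \<otimes> y \<otimes> inv x \<in> B" using c by (simp add: m_assoc)
qed

text \<open>Powers are multiplicative in the abelian quotient \<open>A/B\<close>. In the induction
  step \<open>x\<close> is moved past \<open>y^n\<close> at the cost of a commutator conjugated by
  \<open>x^n\<close>, which stays in the normalised \<open>B\<close>.\<close>

lemma nat_pow_mult_mod:
  assumes A: "subgroup A G" and B: "subgroup B G" "B \<subseteq> A"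
    and comm: "\<And>x y. x \<in> A \<Longrightarrow> y \<in> A \<Longrightarrow> x \<otimes> y \<otimes> inv x \<otimes> inv y \<in> B"
    and x: "x \<in> A" and y: "y \<in> A"
  shows "(x \<otimes> y) [^] (n::nat) \<otimes> inv (x [^] n \<otimes> y [^] n) \<in> B"
proof (induction n)
  case 0
  then show ?case using subgroup.one_closed[OF B(1)] by simp
next
  case (Suc n)
  have c: "x \<in> carrier G" "y \<in> carrier G" using x y subgroup.mem_carrier[OF A] by auto
  have "x [^] n \<otimes> (y [^] n \<otimes> x \<otimes> inv (y [^] n) \<otimes> inv x) \<otimes> inv (x [^] n) \<in> B"
    using normalizesD[OF normalizes_of_commutators[OF A B comm] subgroup_nat_pow_closed[OF A x]
        comm[OF subgroup_nat_pow_closed[OF A y] x]] .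
  then have "((x \<otimes> y) [^] n \<otimes> inv (x [^] n \<otimes> y [^] n)) \<otimes>
      (x [^] n \<otimes> (y [^] n \<otimes> x \<otimes> inv (y [^] n) \<otimes> inv x) \<otimes> inv (x [^] n)) \<in> B"
    using subgroup.m_closed[OF B(1) Suc.IH] by blast
  moreover have "(x \<otimes> y) [^] Suc n \<otimes> inv (x [^] Suc n \<otimes> y [^] Suc n) =
      ((x \<otimes> y) [^] n \<otimes> inv (x [^] n \<otimes> y [^] n)) \<otimes>
      (x [^] n \<otimes> (y [^] n \<otimes> x \<otimes> inv (y [^] n) \<otimes> inv x) \<otimes> inv (x [^] n))"
    using c by (simp add: m_assoc inv_mult_group)
  ultimately show ?case by simp
qed

text \<open>\<open>A\<close> has no finite generating set to work with, so the exponent is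
  transported from \<open>M\<close>. The elements of \<open>A\<close> killed by \<open>e\<close>
  modulo \<open>B\<close> form a subgroup \<open>C\<close> normalised by \<open>H\<close>; then
  \<open>H <#> C\<close> contains the generators of \<open>M\<close>, and this forces
  \<open>C = A\<close>.\<close>

lemma fin_index_periodic_extension:
  assumes b: "bounded_sections_finite G {\<one>} (carrier G)"
    and M: "subgroup M G" "finite S" "generate G S = M" "S \<subseteq> M"
    and H: "subgroup H G" "H \<subseteq> M" and A: "subgroup A G" "A \<subseteq> M" and MHA: "M \<subseteq> H <#> A"
    and n: "normalizes G M A"
    and comm: "\<And>x y. x \<in> A \<Longrightarrow> y \<in> A \<Longrightarrow> x \<otimes> y \<otimes> inv x \<otimes> inv y \<in> H"
    and per: "periodic_mod G H A"
  shows "fin_index G M H"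
proof -
  define B where "B = A \<inter> H"
  have B: "subgroup B G" "B \<subseteq> A" "B \<subseteq> H" unfolding B_def using subgroups_Inter_pair[OF A(1) H(1)] by auto
  have Hc: "h \<in> carrier G" if "h \<in> H" for h using that subgroup.mem_carrier[OF H(1)] by blast
  have Ac: "a \<in> carrier G" if "a \<in> A" for a using that subgroup.mem_carrier[OF A(1)] by blast
  have commB: "x \<otimes> y \<otimes> inv x \<otimes> inv y \<in> B" if "x \<in> A" "y \<in> A" for x y
    using comm[OF that] subgroup_mult_inv_closed[OF A(1) subgroup_mult_inv_closed[OF A(1)
          subgroup.m_closed[OF A(1) that] that(1)] that(2)] by (simp add: B_def)
  have "\<forall>s\<in>S. \<exists>h a k. h \<in> H \<and> a \<in> A \<and> s = h \<otimes> a \<and> 0 < k \<and> a [^] (k::nat) \<in> H"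
  proof
    fix s assume "s \<in> S"
    then obtain h a where ha: "h \<in> H" "a \<in> A" "s = h \<otimes> a" using M(4) MHA by (auto simp: set_mult_def)
    then show "\<exists>h a k. h \<in> H \<and> a \<in> A \<and> s = h \<otimes> a \<and> 0 < k \<and> a [^] (k::nat) \<in> H"
      using per unfolding periodic_mod_def by blast
  qed
  then obtain h a k where hak: "\<And>s. s \<in> S \<Longrightarrow> h s \<in> H \<and> a s \<in> A \<and> s = h s \<otimes> a s \<and> 0 < k s \<and> a s [^] (k s::nat) \<in> H"
    by metis
  \<comment> \<open>Each \<open>k s\<close> serves only its own \<open>a s\<close>; the product over
    the finite set \<open>S\<close> is a common multiple.\<close>
  define e where "e = (\<Prod>s\<in>S. k s)"
  have e: "0 < e" using hak unfolding e_def by (simp add: prod_pos)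
  define C where "C = {x \<in> A. x [^] e \<in> B}"
  have C: "subgroup C G"
  proof (rule subgroupI)
    show "C \<subseteq> carrier G" using Ac by (auto simp: C_def)
    have "\<one> \<in> C" using subgroup.one_closed[OF A(1)] subgroup.one_closed[OF B(1)] by (simp add: C_def)
    then show "C \<noteq> {}" by blast
    fix x assume x: "x \<in> C"
    then have xA: "x \<in> A" "x [^] e \<in> B" by (auto simp: C_def)
    show "inv x \<in> C"
      using subgroup.m_inv_closed[OF A(1) xA(1)] subgroup.m_inv_closed[OF B(1) xA(2)] Ac[OF xA(1)]
      by (simp add: C_def nat_pow_inv)
    fix y assume y: "y \<in> C"
    then have yA: "y \<in> A" "y [^] e \<in> B" by (auto simp: C_def)
    have "((x \<otimes> y) [^] e \<otimes> inv (x [^] e \<otimes> y [^] e)) \<otimes> (x [^] e \<otimes> y [^] e) \<in> B"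
      using subgroup.m_closed[OF B(1) nat_pow_mult_mod[OF A(1) B(1,2) commB xA(1) yA(1)]
          subgroup.m_closed[OF B(1) xA(2) yA(2)]] by blast
    then have "(x \<otimes> y) [^] e \<in> B" using Ac[OF xA(1)] Ac[OF yA(1)] by (simp add: m_assoc)
    then show "x \<otimes> y \<in> C" using subgroup.m_closed[OF A(1) xA(1) yA(1)] by (simp add: C_def)
  qed
  have nC: "normalizes G H C"
    unfolding normalizes_def
  proof (intro ballI)
    fix g x assume g: "g \<in> H" and "x \<in> C"
    then have x: "x \<in> A" "x [^] e \<in> B" by (auto simp: C_def)
    have conjA: "g \<otimes> z \<otimes> inv g \<in> A" if "z \<in> A" for z using normalizesD[OF n _ that] g H(2) by blast
    have "g \<otimes> x [^] e \<otimes> inv g \<in> H"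
      using subgroup_mult_inv_closed[OF H(1) subgroup.m_closed[OF H(1) g] g] x(2) B(3) by blast
    then have "(g \<otimes> x \<otimes> inv g) [^] e \<in> B"
      using conjA[OF subgroup_nat_pow_closed[OF A(1) x(1)]] nat_pow_conj[OF Hc[OF g] Ac[OF x(1)]]
      by (simp add: B_def)
    then show "g \<otimes> x \<otimes> inv g \<in> C" using conjA[OF x(1)] by (simp add: C_def)
  qed
  have HC: "subgroup (H <#> C) G" using subgroup_set_mult[OF H(1) C nC] .
  have "s \<in> H <#> C" if s: "s \<in> S" for s
  proof -
    have hs: "h s \<in> H" "a s \<in> A" "s = h s \<otimes> a s" "a s [^] k s \<in> H" using hak[OF s] by auto
    have "k s dvd e" unfolding e_def using M(2) s by (rule dvd_prodI)
    then obtain l where "e = k s * l" by (elim dvdE)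
    then have "a s [^] e \<in> H"
      using subgroup_nat_pow_closed[OF H(1) hs(4), of l] Ac[OF hs(2)] by (simp add: nat_pow_pow)
    then have "a s \<in> C" using hs(2) subgroup_nat_pow_closed[OF A(1) hs(2)] by (simp add: C_def B_def)
    then show ?thesis using hs(1,3) unfolding set_mult_def by blast
  qed
  then have MHC: "M \<subseteq> H <#> C" using generate_subgroup_incl[OF _ HC] M(3) by blast
  \<comment> \<open>Dedekind's modular law: if \<open>x = g c\<close> with \<open>x\<close> and
    \<open>c\<close> in \<open>A\<close>, then \<open>g\<close> lies in
    \<open>A \<inter> H = B\<close>, hence in \<open>C\<close>, and so does
    \<open>x\<close>.\<close>
  have pow: "x [^] e \<in> B" if x: "x \<in> A" for x
  proof -
    obtain g c where gc: "g \<in> H" "c \<in> C" "x = g \<otimes> c" using x A(2) MHC by (auto simp: set_mult_def)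
    have cA: "c \<in> A" using gc(2) by (simp add: C_def)
    have "g = x \<otimes> inv c" using gc(3) Hc[OF gc(1)] Ac[OF cA] by (simp add: m_assoc)
    then have "g \<in> B" using gc(1) subgroup_mult_inv_closed[OF A(1) x cA] by (simp add: B_def)
    then have "g \<in> C" using subgroup_nat_pow_closed[OF B(1)] B(2) by (auto simp: C_def)
    then have "x \<in> C" using gc(2,3) subgroup.m_closed[OF C] by blast
    then show ?thesis by (simp add: C_def)
  qed
  have "fin_index G A B"
    by (rule bounded_sections_finiteD[OF b A(1) B(1,2) subgroup.subset[OF A(1)] _ e commB pow])
      (use subgroup.one_closed[OF B(1)] in auto)
  then obtain F where F: "finite F" "F \<subseteq> carrier G" "\<And>x. x \<in> A \<Longrightarrow> \<exists>f\<in>F. x \<otimes> inv f \<in> B"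
    unfolding fin_index_def by blast
  have "\<exists>f\<in>F. m \<otimes> inv f \<in> H" if m: "m \<in> M" for m
  proof -
    obtain g x where gx: "g \<in> H" "x \<in> A" "m = g \<otimes> x" using m MHA by (auto simp: set_mult_def)
    obtain f where f: "f \<in> F" "x \<otimes> inv f \<in> B" using F(3)[OF gx(2)] by blast
    then have "g \<otimes> (x \<otimes> inv f) \<in> H" using subgroup.m_closed[OF H(1) gx(1)] B(3) by blast
    moreover have "f \<in> carrier G" using f(1) F(2) by blast
    ultimately have "m \<otimes> inv f \<in> H" using gx(3) Hc[OF gx(1)] Ac[OF gx(2)] by (simp add: m_assoc)
    then show ?thesis using f(1) by blast
  qed
  then show ?thesis using F(1,2) unfolding fin_index_def by blast
qed

text \<open>If \<open>A\<close> were not periodic modulo \<open>H \<inter> A\<close>, a further jump could be inserted into the chain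
  of length \<open>r\<close> in \<open>H\<close>, split along \<open>A\<close>.\<close>

lemma periodic_mod_of_full_rank:
  assumes G: "hirsch_chain G {\<one>} r (carrier G)" and H: "rank_chain G {\<one>} r H"
    and A: "subgroup A G" "normalizes G (carrier G) A"
    and comm: "\<And>x y. x \<in> A \<Longrightarrow> y \<in> A \<Longrightarrow> x \<otimes> y \<otimes> inv x \<otimes> inv y \<in> H"
  shows "periodic_mod G H A"
proof (rule ccontr)
  assume "\<not> periodic_mod G H A"
  then have np: "\<not> periodic_mod G (H \<inter> A) A" using periodic_mod_mono[of G "H \<inter> A" A H A] by blast
  have sH: "subgroup H G" using rank_chain_subgroup[OF H] by blast
  have nH: "normalizes G H A" using normalizes_subset[OF A(2) subgroup.subset[OF sH]] .
  obtain i j where ij: "i + j = r" "rank_chain G {\<one>} i (H \<inter> A)" "rank_chain G A j (H <#> A)"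
    using rank_chain_split[OF H A(1) nH] by blast
  have "x \<otimes> y \<otimes> inv x \<otimes> inv y \<in> H \<inter> A" if "x \<in> A" "y \<in> A" for x y
    using comm[OF that] subgroup_mult_inv_closed[OF A(1) subgroup_mult_inv_closed[OF A(1)
          subgroup.m_closed[OF A(1) that] that(1)] that(2)] by simp
  then have "normalizes G A (H \<inter> A)"
    using normalizes_of_commutators[OF A(1) subgroups_Inter_pair[OF sH A(1)]] by blast
  then have "rank_chain G {\<one>} (Suc i) A" using rank_chain.rc_jump[OF ij(2) A(1) _ _ np] by blast
  then have "rank_chain G {\<one>} (Suc i + j) (H <#> A)" using rank_chain_trans[OF ij(3)] by blast
  moreover have "H <#> A \<subseteq> carrier G"
    using set_mult_closed[OF subgroup.subset[OF sH] subgroup.subset[OF A(1)]] .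
  ultimately have "Suc i + j \<le> r" using rank_chain_le_hirsch_chain[OF G] by blast
  then show False using ij(1) by simp
qed

lemma fin_index_of_full_rank:
  assumes G: "hirsch_chain G {\<one>} r (carrier G)" and H: "rank_chain G {\<one>} r H"
    and b: "bounded_sections_finite G {\<one>} (carrier G)"
    and fg: "finitely_generated_group G" and "solvable G"
  shows "fin_index G (carrier G) H"
proof -
  obtain S where S: "finite S" "S \<subseteq> carrier G" "generate G S = carrier G"
    using fg unfolding finitely_generated_group_def by blast
  have sH: "subgroup H G" using rank_chain_subgroup[OF H] by blast
  define D where "D i = (derived G ^^ i) (carrier G)" for i
  have D: "subgroup (D i) G" "normalizes G (carrier G) (D i)" for i
  proof -
    have "D i \<lhd> G" by (induction i) (simp_all add: D_def normal_self derived_is_normal)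
    then show "subgroup (D i) G" "normalizes G (carrier G) (D i)"
      unfolding normal_inv_iff normalizes_def by blast+
  qed
  have HD: "subgroup (H <#> D i) G" for i
    using subgroup_set_mult[OF sH D(1) normalizes_subset[OF D(2) subgroup.subset[OF sH]]] .
  have "fin_index G (carrier G) (H <#> D i)" for i
  proof (induction i)
    case 0
    have "carrier G \<subseteq> H <#> D 0" using set_mult_supset(2)[OF sH D(1)[of 0]] by (simp add: D_def)
    then show ?case by (rule fin_index_subset) simp
  next
    case (Suc i)
    obtain U where U: "finite U" "U \<subseteq> H <#> D i" "generate G U = H <#> D i"
      using generated_by_finite_of_fin_index[OF S HD Suc.IH] by blast
    have DS: "D (Suc i) \<subseteq> D i" using derived_incl[OF order_refl D(1)] by (simp add: D_def)
    have HS: "H \<subseteq> H <#> D (Suc i)" "D (Suc i) \<subseteq> H <#> D (Suc i)"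
      using set_mult_supset[OF sH D(1)] by auto
    have comm: "x \<otimes> y \<otimes> inv x \<otimes> inv y \<in> H <#> D (Suc i)" if "x \<in> D i" "y \<in> D i" for x y
    proof -
      have "x \<otimes> y \<otimes> inv x \<otimes> inv y \<in> derived_set G (D i)" using that by blast
      then have "x \<otimes> y \<otimes> inv x \<otimes> inv y \<in> derived G (D i)"
        unfolding derived_def by (rule generate.incl)
      then show ?thesis using HS(2) by (auto simp: D_def)
    qed
    have "fin_index G (H <#> D i) (H <#> D (Suc i))"
    proof (rule fin_index_periodic_extension[OF b HD U(1,3,2) HD _ D(1) _ _ _ comm])
      show "H <#> D (Suc i) \<subseteq> H <#> D i" using DS by (intro mono_set_mult) auto
      show "D i \<subseteq> H <#> D i" using set_mult_supset(2)[OF sH D(1)] .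
      show "H <#> D i \<subseteq> (H <#> D (Suc i)) <#> D i" using HS(1) by (intro mono_set_mult) auto
      show "normalizes G (H <#> D i) (D i)" using normalizes_subset[OF D(2) subgroup.subset[OF HD]] .
      \<comment> \<open>The chain of rank \<open>r\<close> in \<open>H\<close> is also one in the
        larger \<open>H <#> D (Suc i)\<close>, so full rank need not be proved anew at each
        stage.\<close>
      show "periodic_mod G (H <#> D (Suc i)) (D i)"
        using periodic_mod_of_full_rank[OF G rank_chain.rc_mono[OF H HD HS(1)] D comm] .
    qed
    then show ?case using fin_index_trans[OF Suc.IH _ HD order_refl subgroup.subset[OF HD]] by blast
  qed
  moreover obtain n where "D n = {\<one>}"
    using assms(5) solvable_iff_trivial_derived_seq unfolding D_def by blast
  moreover have "H <#> {\<one>} = H" using subgroup.subset[OF sH] by (auto simp: set_mult_def subset_iff)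
  ultimately show ?thesis by metis
qed

end

theorem theorem3p1:
  fixes G :: "('a, 'b) monoid_scheme" and H :: "'a set"
  assumes "solvable_FAR_group G"
    and "finitely_generated_group G"
    and "subgroup H G"
  shows "finite (rcosets\<^bsub>G\<^esub> H) \<longleftrightarrow> hirsch_number (G\<lparr>carrier := H\<rparr>) = hirsch_number G"
proof -
  interpret group G using assms(1) by (simp add: solvable_FAR_group_def)
  have sol: "solvable G" using assms(1) by (simp add: solvable_FAR_group_def)
  have Hc: "H \<subseteq> carrier G" using subgroup.subset[OF assms(3)] .
  obtain r where r: "hirsch_chain G {\<one>\<^bsub>G\<^esub>} r (carrier G)" using solvable_FAR_group_bounds(1)[OF assms(1)] by blast
  \<comment> \<open>\<open>H\<close> must have a Hirsch series of its own; otherwise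
    \<open>hirsch_number\<close> would be an unspecified value there.\<close>
  obtain s where "hirsch_chain G {\<one>\<^bsub>G\<^esub>} s (carrier G \<inter> H)" using hirsch_chain_Int[OF r assms(3)] by blast
  then have s: "hirsch_chain G {\<one>\<^bsub>G\<^esub>} s H" using Hc by (simp add: Int_absorb1)
  have hG: "hirsch_number G = r" using hirsch_number_eq[OF r] by simp
  have hH: "hirsch_number (G\<lparr>carrier := H\<rparr>) = s" using hirsch_number_eq[OF s] .
  have sr: "s \<le> r" using rank_chain_le_hirsch_chain[OF r hirsch_chain_imp_rank_chain[OF s] Hc] .
  have "fin_index G (carrier G) H \<longleftrightarrow> s = r"
  proof
    assume "fin_index G (carrier G) H"
    \<comment> \<open>A chain of rank \<open>r\<close> in \<open>G\<close> keeps its rank when cut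
      by \<open>H\<close>, which gives the inequality that monotonicity does not.\<close>
    then have "rank_chain G {\<one>\<^bsub>G\<^esub>} r (carrier G \<inter> H)"
      using rank_chain_Int_root[OF hirsch_chain_imp_rank_chain[OF r] assms(3)]
        fin_index_periodic_mod[OF assms(3)] by blast
    then have "r \<le> s" using rank_chain_le_hirsch_chain[OF s] by blast
    then show "s = r" using sr by simp
  next
    assume "s = r"
    then have "rank_chain G {\<one>\<^bsub>G\<^esub>} r H" using hirsch_chain_imp_rank_chain[OF s] by simp
    then show "fin_index G (carrier G) H"
      using fin_index_of_full_rank[OF r _ solvable_FAR_group_bounds(2)[OF assms(1)] assms(2) sol] by blast
  qed
  then show ?thesis using fin_index_iff_finite_rcosets[OF assms(3)] hG hH by simp
qed

end
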